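(* Let $\mathscr{E}$ be a Hilbert $C^*$-module over a $C^*$-algebra $\mathfrak{A}$, let $L$ be a conditionally negative definite kernel on a nonempty set $S$ into $\mathcal{L}(\mathscr{E})$, let $s_0\in S$, and let $$K(s,t):=\frac12\left[L(s,s_0)+L(s_0,t)-L(s,t)-L(s_0,s_0)\right],\qquad s,t\in S.$$ Then $K$ is a positive definite kernel, and there are a reproducing kernel Hilbert $C^*$-module $\mathscr{H}$ (associated with $K$) consisting of functions from $S$ into $\mathscr{E}$ and a map $\psi:S\to\mathcal{L}(\mathscr{E})$ such that $$L(s,t)=K(s,s)+K(t,t)-2K(s,t)+\psi(s)+\psi(t)^*,\qquad s,t\in S.$$ In particular, this $\psi$ is identically zero if and only if $L$ is normalized and $L(s,s_0)$ is self-adjoint for all $s\in S$.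
   Context: Hilbert modules are right modules with inner product linear in the second variable. $\mathcal{L}(\mathscr{E})$ is the $C^*$-algebra of adjointable operators on $\mathscr{E}$. A kernel is a map $K:S\times S\to\mathcal{L}(\mathscr{E})$; it is hermitian if $K(t,s)=K(s,t)^*$ for all $s,t\in S$. A (hermitian) kernel $K$ is positive definite if $\sum_{i,j=1}^n\langle K(s_i,s_j)x_i,x_j\rangle\ge0$ in $\mathfrak{A}$ for all $n\ge2$, $s_1,\dots,s_n\in S$, $x_1,\dots,x_n\in\mathscr{E}$. A hermitian kernel $L$ is conditionally negative definite if $\sum_{i,j=1}^n\langle L(s_i,s_j)x_i,x_j\rangle\le0$ for all $n\ge2$, $s_1,\dots,s_n\in S$ and $x_1,\dots,x_n\in\mathscr{E}$ with $\sum_{i=1}^nx_i=0$; it is normalized if $L(s,s)=0$ for all $s\in S$. The reproducing kernel Hilbert $C^*$-module associated with a positive definite kernel $K$ is the Hilbert $\mathfrak{A}$-module $\mathscr{H}$ of $\mathscr{E}$-valued functions on $S$ (pointwise linear operations and $(f\cdot a)(s)=f(s)a$) such that the functions $K_{x,s}(t):=K(s,t)(x)$ belong to $\mathscr{H}$ for all $x\in\mathscr{E}$, $s\in S$, have dense $\mathfrak{A}$-linear span in $\mathscr{H}$, satisfy $\langle K_{x,s},K_{y,t}\rangle=\langle K(s,t)x,y\rangle$, and $\langle f(s),x\rangle=\langle f,K_{x,s}\rangle$ for all $f\in\mathscr{H}$, $x\in\mathscr{E}$, $s\in S$. *)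

theory Defs
  imports Complex_Main "HOL-Library.Function_Algebras"
begin

class complex_vector = ab_group_add +
  fixes scaleC :: "complex \<Rightarrow> 'a \<Rightarrow> 'a"  (infixr "*\<^sub>C" 75)
  assumes scaleC_add_right: "c *\<^sub>C (x + y) = c *\<^sub>C x + c *\<^sub>C y"
    and scaleC_add_left: "(c + d) *\<^sub>C x = c *\<^sub>C x + d *\<^sub>C x"
    and scaleC_scaleC: "c *\<^sub>C (d *\<^sub>C x) = (c * d) *\<^sub>C x"
    and scaleC_one: "1 *\<^sub>C x = x"

(* Addition and subtraction of functions are the pointwise ones of Function_Algebras. *)

instantiation "fun" :: (type, complex_vector) complex_vector
begin

definition scaleC_fun :: "complex \<Rightarrow> ('a \<Rightarrow> 'b) \<Rightarrow> 'a \<Rightarrow> 'b"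
  where "scaleC_fun c f = (\<lambda>x. c *\<^sub>C f x)"

instance
  by standard
    (simp_all add: scaleC_fun_def fun_eq_iff scaleC_add_right scaleC_add_left
       scaleC_scaleC scaleC_one)

end

(* No unit is assumed. *)

class cstar_algebra = complex_vector + real_normed_algebra + banach +
  fixes star :: "'a \<Rightarrow> 'a"
  assumes scaleR_eq_scaleC: "r *\<^sub>R a = complex_of_real r *\<^sub>C a"
    and norm_scaleC: "norm (c *\<^sub>C a) = cmod c * norm a"
    and scaleC_mult_left: "(c *\<^sub>C a) * b = c *\<^sub>C (a * b)"
    and scaleC_mult_right: "a * (c *\<^sub>C b) = c *\<^sub>C (a * b)"
    and star_star: "star (star a) = a"
    and star_add: "star (a + b) = star a + star b"
    and star_scaleC: "star (c *\<^sub>C a) = cnj c *\<^sub>C star a"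
    and star_mult: "star (a * b) = star b * star a"
    and norm_star_mult: "norm (star a * a) = (norm a)\<^sup>2"

definition cstar_pos :: "'a::cstar_algebra \<Rightarrow> bool"
  where "cstar_pos a \<longleftrightarrow> (\<exists>b. a = star b * b)"

definition module_norm :: "('x \<Rightarrow> 'x \<Rightarrow> 'a::cstar_algebra) \<Rightarrow> 'x \<Rightarrow> real"
  where "module_norm ip x = sqrt (norm (ip x x))"

(* The module is a subset of a complex vector space, so that one notion covers both a module
   filling a whole type and a module consisting of some of the functions into another module. *)

locale hilbert_cstar_module =
  fixes X :: "'x::complex_vector set"
    and act :: "'x \<Rightarrow> 'a::cstar_algebra \<Rightarrow> 'x"
    and ip :: "'x \<Rightarrow> 'x \<Rightarrow> 'a"
  assumes zero_mem: "0 \<in> X"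
    and add_mem: "x \<in> X \<Longrightarrow> y \<in> X \<Longrightarrow> x + y \<in> X"
    and scaleC_mem: "x \<in> X \<Longrightarrow> c *\<^sub>C x \<in> X"
    and act_mem: "x \<in> X \<Longrightarrow> act x a \<in> X"
    and act_add_left: "x \<in> X \<Longrightarrow> y \<in> X \<Longrightarrow> act (x + y) a = act x a + act y a"
    and act_add_right: "x \<in> X \<Longrightarrow> act x (a + b) = act x a + act x b"
    and act_mult: "x \<in> X \<Longrightarrow> act x (a * b) = act (act x a) b"
    and act_scaleC_left: "x \<in> X \<Longrightarrow> act (c *\<^sub>C x) a = c *\<^sub>C act x a"
    and act_scaleC_right: "x \<in> X \<Longrightarrow> act x (c *\<^sub>C a) = c *\<^sub>C act x a"
    and ip_add_right: "x \<in> X \<Longrightarrow> y \<in> X \<Longrightarrow> z \<in> X \<Longrightarrow> ip x (y + z) = ip x y + ip x z"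
    and ip_scaleC_right: "x \<in> X \<Longrightarrow> y \<in> X \<Longrightarrow> ip x (c *\<^sub>C y) = c *\<^sub>C ip x y"
    and ip_act_right: "x \<in> X \<Longrightarrow> y \<in> X \<Longrightarrow> ip x (act y a) = ip x y * a"
    and ip_star: "x \<in> X \<Longrightarrow> y \<in> X \<Longrightarrow> ip y x = star (ip x y)"
    and ip_pos: "x \<in> X \<Longrightarrow> cstar_pos (ip x x)"
    and ip_definite: "x \<in> X \<Longrightarrow> ip x x = 0 \<Longrightarrow> x = 0"
    and complete:
      "(\<And>n. f n \<in> X) \<Longrightarrow>
       (\<And>e. e > 0 \<Longrightarrow> \<exists>N. \<forall>m\<ge>N. \<forall>n\<ge>N. module_norm ip (f m - f n) < e) \<Longrightarrow>
       \<exists>l\<in>X. (\<lambda>n. module_norm ip (f n - l)) \<longlonglongrightarrow> 0"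

definition is_adjoint ::
    "('e \<Rightarrow> 'e \<Rightarrow> 'a::cstar_algebra) \<Rightarrow> ('e \<Rightarrow> 'e) \<Rightarrow> ('e \<Rightarrow> 'e) \<Rightarrow> bool"
  where "is_adjoint ip T T' \<longleftrightarrow> (\<forall>x y. ip (T x) y = ip x (T' y))"

(* Membership in the algebra of adjointable operators; adjointable maps are automatically
   linear and bounded. *)

definition adjointable :: "('e \<Rightarrow> 'e \<Rightarrow> 'a::cstar_algebra) \<Rightarrow> ('e \<Rightarrow> 'e) \<Rightarrow> bool"
  where "adjointable ip T \<longleftrightarrow> (\<exists>T'. is_adjoint ip T T')"

(* Meaningful for adjointable T only; the adjoint is then unique because ip is definite. *)

definition op_adj :: "('e \<Rightarrow> 'e \<Rightarrow> 'a::cstar_algebra) \<Rightarrow> ('e \<Rightarrow> 'e) \<Rightarrow> 'e \<Rightarrow> 'e"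
  where "op_adj ip T = (THE T'. is_adjoint ip T T')"

definition hermitian_kernel ::
    "('e \<Rightarrow> 'e \<Rightarrow> 'a::cstar_algebra) \<Rightarrow> ('s \<Rightarrow> 's \<Rightarrow> 'e \<Rightarrow> 'e) \<Rightarrow> bool"
  where "hermitian_kernel ip K \<longleftrightarrow>
    (\<forall>s t. adjointable ip (K s t)) \<and> (\<forall>s t. K t s = op_adj ip (K s t))"

definition positive_definite_kernel ::
    "('e \<Rightarrow> 'e \<Rightarrow> 'a::cstar_algebra) \<Rightarrow> ('s \<Rightarrow> 's \<Rightarrow> 'e \<Rightarrow> 'e) \<Rightarrow> bool"
  where "positive_definite_kernel ip K \<longleftrightarrow>
    hermitian_kernel ip K \<and>
    (\<forall>n\<ge>2. \<forall>(s :: nat \<Rightarrow> 's) (x :: nat \<Rightarrow> 'e).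
       cstar_pos (\<Sum>i=1..n. \<Sum>j=1..n. ip (K (s i) (s j) (x i)) (x j)))"

definition cond_negative_definite_kernel ::
    "('e::complex_vector \<Rightarrow> 'e \<Rightarrow> 'a::cstar_algebra) \<Rightarrow> ('s \<Rightarrow> 's \<Rightarrow> 'e \<Rightarrow> 'e) \<Rightarrow> bool"
  where "cond_negative_definite_kernel ip L \<longleftrightarrow>
    hermitian_kernel ip L \<and>
    (\<forall>n\<ge>2. \<forall>(s :: nat \<Rightarrow> 's) (x :: nat \<Rightarrow> 'e). (\<Sum>i=1..n. x i) = 0 \<longrightarrow>
       cstar_pos (- (\<Sum>i=1..n. \<Sum>j=1..n. ip (L (s i) (s j) (x i)) (x j))))"

definition normalized_kernel :: "('s \<Rightarrow> 's \<Rightarrow> 'e::complex_vector \<Rightarrow> 'e) \<Rightarrow> bool"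
  where "normalized_kernel L \<longleftrightarrow> (\<forall>s. L s s = 0)"

definition kernel_fun :: "('s \<Rightarrow> 's \<Rightarrow> 'e \<Rightarrow> 'e) \<Rightarrow> 'e \<Rightarrow> 's \<Rightarrow> 's \<Rightarrow> 'e"
  where "kernel_fun K x s = (\<lambda>t. K s t x)"

definition fun_act :: "('e \<Rightarrow> 'a \<Rightarrow> 'e) \<Rightarrow> ('s \<Rightarrow> 'e) \<Rightarrow> 'a \<Rightarrow> 's \<Rightarrow> 'e"
  where "fun_act act f a = (\<lambda>s. act (f s) a)"

(* All coefficients are taken in the algebra, even if it has no unit. *)

definition module_span ::
    "('x::complex_vector \<Rightarrow> 'a::cstar_algebra \<Rightarrow> 'x) \<Rightarrow> 'x set \<Rightarrow> 'x set"
  where "module_span act M =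
    {\<Sum>i<n. act (g i) (a i) | (n::nat) (g :: nat \<Rightarrow> 'x) (a :: nat \<Rightarrow> 'a). \<forall>i<n. g i \<in> M}"

definition reproducing_kernel_module ::
    "('e::complex_vector \<Rightarrow> 'a::cstar_algebra \<Rightarrow> 'e) \<Rightarrow> ('e \<Rightarrow> 'e \<Rightarrow> 'a) \<Rightarrow>
     ('s \<Rightarrow> 's \<Rightarrow> 'e \<Rightarrow> 'e) \<Rightarrow> ('s \<Rightarrow> 'e) set \<Rightarrow> (('s \<Rightarrow> 'e) \<Rightarrow> ('s \<Rightarrow> 'e) \<Rightarrow> 'a) \<Rightarrow> bool"
  where "reproducing_kernel_module act ip K H ipH \<longleftrightarrow>
    hilbert_cstar_module H (fun_act act) ipH \<and>
    (\<forall>x s. kernel_fun K x s \<in> H) \<and>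
    (\<forall>f\<in>H. \<forall>e>0. \<exists>g\<in>module_span (fun_act act) {kernel_fun K x s | x s. True}.
       module_norm ipH (f - g) < e) \<and>
    (\<forall>x y s t. ipH (kernel_fun K x s) (kernel_fun K y t) = ip (K s t x) y) \<and>
    (\<forall>f\<in>H. \<forall>x s. ip (f s) x = ipH f (kernel_fun K x s))"

end

theory Submission
  imports Defs "HOL-Analysis.Operator_Norm"
begin

text \<open>
  Positive definiteness of \<open>K\<close> is the classical trick for conditionally negative kernels: given points
  \<open>s\<^sub>i\<close> and vectors \<open>x\<^sub>i\<close>, add the base point \<open>s0\<close> with the vector \<open>- (\<Sum>i. x\<^sub>i)\<close>. The vectors now sum to zero,
  and expanding the quadratic form of \<open>L\<close> at the enlarged system gives \<open>-2\<close> times the quadratic form of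
  \<open>K\<close> at the original one (\<open>positive_definite_of_cond_negative\<close>). The identity for \<open>L\<close> determines
  \<open>\<psi> s + (\<psi> t)\<^sup>*\<close>, and \<open>\<psi> s = (L s s + L s s0 - L s0 s) / 2\<close> is a solution. Its self-adjoint part is
  \<open>L s s / 2\<close> and its skew-adjoint part is \<open>(L s s0 - L s0 s) / 2\<close>, so that \<open>\<psi>\<close> vanishes exactly
  if \<open>L\<close> is normalized and every \<open>L s s0\<close> is self-adjoint.

  The weight of the theorem lies in the reproducing kernel module. On finite sums of kernel functions
  the inner product is prescribed, and it is well defined because
  \<open>\<langle>f, \<Sum> K\<^bsub>y,t\<^esub>\<rangle> = \<Sum> \<langle>f t, y\<rangle>\<close> depends on \<open>f\<close> as a function only. The module is the completion of
  this space, and the elements of the completion must again be functions. For this two things are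
  needed: evaluation at a point is bounded, and a Cauchy sequence that tends to zero pointwise
  tends to zero in norm. The first one holds because an everywhere defined operator with an
  adjoint is bounded (\<open>adjointable_bounded\<close>), the second one because the inner product with a fixed
  finite sum only sees finitely many values. The locale \<open>function_module\<close> carries out the completion
  under these two conditions, and \<open>positive_kernel.reproducing\<close> applies it. Kernel functions lie in the
  closed span with coefficients in the algebra because \<open>x \<cdot> u\<close> comes arbitrarily close to \<open>x\<close>
  (\<open>approximate_by_act\<close>).

  All of this rests on the order of a \<open>C\<^sup>*\<close>-algebra: the elements \<open>b\<^sup>* b\<close> form a closed convex cone on which
  the norm is monotone. This gives the Cauchy-Schwarz inequality and makes limits of
  positive inner products positive. The route to it avoids spectral theory. In a unital algebra
  call a self-adjoint \<open>a\<close> positive if \<open>norm (t - a) \<le> t\<close> for some \<open>t\<close>; these elements visibly form a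
  cone. A convergent iteration yields square roots in this cone, and writing two commuting
  self-adjoint elements as the real and imaginary part of a multiple of a unitary shows that squares
  of self-adjoint elements belong to it. The theorem \<open>norm_pos_star_mult\<close> of Fukamiya, Kelley and Vaught then
  identifies the cone with the elements \<open>b\<^sup>* b\<close>. Algebras without a unit are embedded isometrically
  into their unitization.
\<close>

section \<open>Involution and norm\<close>

lemma star_zero [simp]: "star (0::'a::cstar_algebra) = 0"
  using star_add[of 0 0] by simp

lemma star_minus: "star (- a) = - star (a::'a::cstar_algebra)"
  using star_add[of "- a" a] by (simp add: eq_neg_iff_add_eq_0)

lemma star_diff: "star (a - b) = star a - star (b::'a::cstar_algebra)"
  by (metis diff_conv_add_uminus star_add star_minus)

lemma star_scaleR: "star (r *\<^sub>R a) = r *\<^sub>R star (a::'a::cstar_algebra)"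
  by (simp add: scaleR_eq_scaleC star_scaleC)

lemmas star_simps = star_add star_diff star_minus star_scaleR star_scaleC star_mult star_star

lemma norm_le_norm_star: "norm (a::'a::cstar_algebra) \<le> norm (star a)"
proof (cases "a = 0")
  case False
  have "norm a * norm a \<le> norm (star a) * norm a"
    using norm_mult_ineq[of "star a" a] by (simp add: norm_star_mult power2_eq_square)
  with False show ?thesis by simp
qed simp

lemma norm_star [simp]: "norm (star a) = norm (a::'a::cstar_algebra)"
  using norm_le_norm_star[of a] norm_le_norm_star[of "star a"] by (simp add: star_star)

lemma bounded_linear_star: "bounded_linear (star :: 'a::cstar_algebra \<Rightarrow> 'a)"
  by (rule bounded_linear_intro[of _ 1]) (auto simp: star_simps)

lemmas tendsto_star [tendsto_intros] = bounded_linear.tendsto[OF bounded_linear_star]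

lemma star_one [simp]: "star (1::'a::{cstar_algebra,real_normed_algebra_1}) = 1"
  by (metis mult_1_right star_mult star_star mult_1_left)

lemma norm_square_selfadjoint: "star a = a \<Longrightarrow> norm (a * a) = (norm (a::'a::cstar_algebra))\<^sup>2"
  by (metis norm_star_mult)

lemma scaleC_zero_left [simp]: "(0::complex) *\<^sub>C x = (0::'x::complex_vector)"
  using scaleC_add_left[of 0 0 x] by simp

lemma scaleC_minus_left: "(- c) *\<^sub>C x = - (c *\<^sub>C (x::'x::complex_vector))"
  using scaleC_add_left[of "- c" c x] by (simp add: eq_neg_iff_add_eq_0)

lemma scaleC_zero_right [simp]: "c *\<^sub>C (0::'x::complex_vector) = 0"
  using scaleC_add_right[of c 0 0] by simp

lemma scaleC_minus_right: "c *\<^sub>C (- x) = - (c *\<^sub>C (x::'x::complex_vector))"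
  using scaleC_add_right[of c "- x" x] by (simp add: eq_neg_iff_add_eq_0)

lemma scaleC_diff_right: "c *\<^sub>C (x - y) = c *\<^sub>C x - c *\<^sub>C (y::'x::complex_vector)"
  by (metis diff_conv_add_uminus scaleC_add_right scaleC_minus_right)

lemma minus_one_scaleC: "(- 1) *\<^sub>C x = - (x::'x::complex_vector)"
  by (simp add: scaleC_minus_left scaleC_one)

text \<open>
  If \<open>c\<close> and \<open>d\<close> commute, then \<open>u = c + \<i> d\<close> satisfies \<open>u\<^sup>* u = c\<^sup>2 + d\<^sup>2\<close>, so the \<open>C\<^sup>*\<close>-identity bounds
  \<open>norm u\<close>, and \<open>c\<close> and \<open>d\<close> are the real and imaginary part of \<open>u\<close>. This is the substitute for the
  functional calculus: it turns an order relation into a norm estimate.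
\<close>

lemma norm_le_of_commuting_squares:
  fixes c d :: "'a::cstar_algebra"
  assumes sa: "star c = c" "star d = d" and comm: "c * d = d * c"
    and r: "norm (c * c + d * d) \<le> r\<^sup>2" and r0: "r \<ge> 0"
  shows "norm c \<le> r" and "norm d \<le> r"
proof -
  define u where "u = c + \<i> *\<^sub>C d"
  have su: "star u = c - \<i> *\<^sub>C d"
    by (simp add: u_def star_simps sa scaleC_minus_left)
  have "star u * u = c * c + d * d"
    unfolding su unfolding u_def
    by (simp add: algebra_simps scaleC_mult_left scaleC_mult_right scaleC_scaleC comm
        minus_one_scaleC scaleC_diff_right scaleC_add_right)
  then have "(norm u)\<^sup>2 \<le> r\<^sup>2" using r norm_star_mult[of u] by simp
  then have nu: "norm u \<le> r" using r0 by (rule power2_le_imp_le)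
  have "2 *\<^sub>R c = u + star u" unfolding su unfolding u_def by (simp add: scaleR_2)
  then have "2 * norm c \<le> norm u + norm (star u)"
    using norm_triangle_ineq[of u "star u"] by (metis norm_scaleR abs_numeral)
  then show "norm c \<le> r" using nu by simp
  have "2 *\<^sub>R (\<i> *\<^sub>C d) = u - star u" unfolding su unfolding u_def by (simp add: scaleR_2)
  then have "2 * norm (\<i> *\<^sub>C d) \<le> norm u + norm (star u)"
    using norm_triangle_ineq4[of u "star u"] by (metis norm_scaleR abs_numeral)
  then show "norm d \<le> r" using nu by (simp add: norm_scaleC)
qed

section \<open>Square roots\<close>

text \<open>
  A fixed point \<open>y\<close> of this iteration satisfies \<open>(1 - y)\<^sup>2 = 1 - x\<close>.
\<close>

primrec sqrt_iter :: "'a::real_normed_algebra_1 \<Rightarrow> nat \<Rightarrow> 'a" where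
  "sqrt_iter x 0 = 0"
| "sqrt_iter x (Suc n) = (1/2) *\<^sub>R (x + sqrt_iter x n * sqrt_iter x n)"

lemma sqrt_iter_commute: "z * x = x * z \<Longrightarrow> z * sqrt_iter x n = sqrt_iter x n * z"
proof (induction n)
  case (Suc n)
  have IH: "z * sqrt_iter x n = sqrt_iter x n * z" using Suc by blast
  have "z * (sqrt_iter x n * sqrt_iter x n) = sqrt_iter x n * (z * sqrt_iter x n)"
    by (simp only: mult.assoc[symmetric] IH) (simp only: mult.assoc IH)
  also have "\<dots> = sqrt_iter x n * sqrt_iter x n * z" by (simp only: IH mult.assoc)
  finally have "z * (sqrt_iter x n * sqrt_iter x n) = sqrt_iter x n * sqrt_iter x n * z" .
  then show ?case by (simp add: algebra_simps Suc.prems)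
qed simp

lemma sqrt_iter_scalar: "0 \<le> sqrt_iter (1::real) n \<and> sqrt_iter (1::real) n \<le> 1"
proof (induction n)
  case (Suc n)
  then have "sqrt_iter (1::real) n * sqrt_iter 1 n \<le> 1 * 1" by (intro mult_mono) auto
  then show ?case by simp
qed simp

text \<open>
  The scalar iteration started with \<open>x = 1\<close> majorizes every iteration with \<open>norm x \<le> 1\<close>, since
  \<open>y\<^sub>n\<^sub>+\<^sub>2 - y\<^sub>n\<^sub>+\<^sub>1 = (y\<^sub>n\<^sub>+\<^sub>1 - y\<^sub>n) (y\<^sub>n\<^sub>+\<^sub>1 + y\<^sub>n) / 2\<close>. It is bounded and increasing, hence convergent, and so the
  increments are summable.
\<close>

lemma sqrt_iter_bounds:
  assumes "norm x \<le> 1"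
  shows "norm (sqrt_iter x n) \<le> sqrt_iter (1::real) n"
    and "norm (sqrt_iter x (Suc n) - sqrt_iter x n) \<le> sqrt_iter (1::real) (Suc n) - sqrt_iter 1 n"
proof -
  show b: "norm (sqrt_iter x n) \<le> sqrt_iter (1::real) n" for n
  proof (induction n)
    case (Suc n)
    have "norm (sqrt_iter x n * sqrt_iter x n) \<le> norm (sqrt_iter x n) * norm (sqrt_iter x n)"
      by (rule norm_mult_ineq)
    also have "\<dots> \<le> sqrt_iter 1 n * sqrt_iter 1 n" using Suc sqrt_iter_scalar[of n] by (intro mult_mono) auto
    finally show ?case
      using norm_triangle_ineq[of x "sqrt_iter x n * sqrt_iter x n"] assms by simp
  qed simp
  show "norm (sqrt_iter x (Suc n) - sqrt_iter x n) \<le> sqrt_iter (1::real) (Suc n) - sqrt_iter 1 n"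
  proof (induction n)
    case 0
    then show ?case using assms by simp
  next
    case (Suc n)
    let ?y = "sqrt_iter x" and ?r = "sqrt_iter (1::real)"
    have comm: "?y (Suc n) * ?y n = ?y n * ?y (Suc n)"
      using sqrt_iter_commute[OF sqrt_iter_commute[OF refl, symmetric]] by blast
    have "?y (Suc (Suc n)) - ?y (Suc n) = (1/2) *\<^sub>R (?y (Suc n) * ?y (Suc n) - ?y n * ?y n)"
      by (simp only: sqrt_iter.simps(2)) (simp add: algebra_simps)
    also have "\<dots> = (1/2) *\<^sub>R ((?y (Suc n) - ?y n) * (?y (Suc n) + ?y n))"
      using comm by (simp add: algebra_simps del: sqrt_iter.simps)
    finally have "norm (?y (Suc (Suc n)) - ?y (Suc n))
        = (1/2) * norm ((?y (Suc n) - ?y n) * (?y (Suc n) + ?y n))" by (simp del: sqrt_iter.simps)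
    also have "\<dots> \<le> (1/2) * (norm (?y (Suc n) - ?y n) * norm (?y (Suc n) + ?y n))"
      using norm_mult_ineq by (intro mult_left_mono) auto
    also have "\<dots> \<le> (1/2) * ((?r (Suc n) - ?r n) * (?r (Suc n) + ?r n))"
    proof (intro mult_left_mono mult_mono)
      show "norm (?y (Suc n) + ?y n) \<le> ?r (Suc n) + ?r n"
        using norm_triangle_ineq[of "?y (Suc n)" "?y n"] b[of n] b[of "Suc n"] by linarith
      show "norm (?y (Suc n) - ?y n) \<le> ?r (Suc n) - ?r n" by (rule Suc)
      then show "0 \<le> ?r (Suc n) - ?r n" using norm_ge_zero order_trans by blast
    qed auto
    also have "\<dots> = ?r (Suc (Suc n)) - ?r (Suc n)"
      by (simp only: sqrt_iter.simps(2)) (simp add: algebra_simps)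
    finally show ?case .
  qed
qed

text \<open>
  The last clause puts the root into the bicommutant of \<open>x\<close>; it is what makes two roots of related
  elements commute later on.
\<close>

lemma sqrt_one_minus_ex:
  fixes x :: "'a::{cstar_algebra,real_normed_algebra_1}"
  assumes x: "norm x \<le> 1" "star x = x"
  obtains d where "star d = d" "d * d = 1 - x" "norm (1 - d) \<le> 1"
    "\<And>z. z * x = x * z \<Longrightarrow> z * d = d * z"
proof -
  let ?y = "sqrt_iter x" and ?r = "sqrt_iter (1::real)"
  have mono: "incseq ?r"
  proof (rule incseq_SucI)
    fix n
    show "?r n \<le> ?r (Suc n)"
      using sqrt_iter_bounds(2)[of "1::real" n] by (simp del: sqrt_iter.simps)
  qed
  have cr: "convergent ?r"
    using mono sqrt_iter_scalar by (meson incseq_convergent convergent_def)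
  then have "summable (\<lambda>n. ?r (Suc n) - ?r n)"
    by (metis convergent_LIMSEQ_iff telescope_summable)
  then have "summable (\<lambda>n. norm (?y (Suc n) - ?y n))"
    by (rule summable_comparison_test'[where N = 0])
      (simp add: sqrt_iter_bounds(2)[OF x(1)] del: sqrt_iter.simps)
  then have "summable (\<lambda>n. ?y (Suc n) - ?y n)" by (rule summable_norm_cancel)
  then have "convergent (\<lambda>n. \<Sum>k<n. ?y (Suc k) - ?y k)"
    by (simp add: summable_iff_convergent)
  then have "convergent ?y" by (simp only: sum_lessThan_telescope) simp
  then obtain y where y: "?y \<longlonglongrightarrow> y" by (auto simp: convergent_def)
  have "(\<lambda>n. ?y (Suc n)) \<longlonglongrightarrow> (1/2) *\<^sub>R (x + y * y)"
    unfolding sqrt_iter.simps by (intro tendsto_intros y)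
  then have eq: "y = (1/2) *\<^sub>R (x + y * y)" using LIMSEQ_Suc[OF y] LIMSEQ_unique by blast
  have "norm (?y n) \<le> 1" for n
    using sqrt_iter_bounds(1)[OF x(1), of n] sqrt_iter_scalar[of n] by linarith
  then have ny: "norm y \<le> 1"
    by (intro LIMSEQ_le_const2[OF tendsto_norm[OF y]]) auto
  have sn: "star (?y n) = ?y n" for n by (induction n) (simp_all add: star_simps x)
  have sy: "star y = y" using tendsto_star[OF y] y by (simp add: sn LIMSEQ_unique)
  have comm: "z * y = y * z" if "z * x = x * z" for z
  proof -
    have "(\<lambda>n. z * ?y n) \<longlonglongrightarrow> z * y" "(\<lambda>n. ?y n * z) \<longlonglongrightarrow> y * z"
      by (intro tendsto_intros y)+
    then show ?thesis using sqrt_iter_commute[OF that] by (simp add: LIMSEQ_unique)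
  qed
  have sq: "(1 - y) * (1 - y) = 1 - x"
  proof -
    have "2 *\<^sub>R y = x + y * y" by (subst eq) simp
    then show ?thesis by (simp add: algebra_simps scaleR_2)
  qed
  show thesis
  proof (rule that[OF _ sq])
    show "star (1 - y) = 1 - y" by (simp add: star_simps sy)
    show "norm (1 - (1 - y)) \<le> 1" using ny by simp
    show "z * (1 - y) = (1 - y) * z" if "z * x = x * z" for z
      using comm[OF that] by (simp add: algebra_simps)
  qed
qed

section \<open>Positivity\<close>

text \<open>
  Positivity expressed by the norm alone: for a self-adjoint element the condition says that the
  spectrum lies in \<open>[0, 2 t]\<close>.
\<close>

definition norm_pos :: "'a::{cstar_algebra,real_normed_algebra_1} \<Rightarrow> bool" where
  "norm_pos a \<longleftrightarrow> star a = a \<and> (\<exists>t\<ge>0. norm (t *\<^sub>R 1 - a) \<le> t)"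

lemma norm_posI: "star a = a \<Longrightarrow> norm (t *\<^sub>R 1 - a) \<le> t \<Longrightarrow> norm_pos a"
  unfolding norm_pos_def using norm_ge_zero order_trans by blast

lemma norm_pos_sqrt:
  fixes a :: "'a::{cstar_algebra,real_normed_algebra_1}"
  assumes "norm_pos a"
  obtains c where "star c = c" "c * c = a" "norm_pos c" "\<And>z. z * a = a * z \<Longrightarrow> z * c = c * z"
proof -
  obtain t where t: "t \<ge> 0" "norm (t *\<^sub>R 1 - a) \<le> t" and sa: "star a = a"
    using assms by (auto simp: norm_pos_def)
  show thesis
  proof (cases "t = 0")
    case True
    then have "a = 0" using t by simp
    then show ?thesis using norm_posI[of "0::'a" 0] by (intro that[of 0]) auto
  next
    case False
    then have tp: "t > 0" using t by simp
    \<comment> \<open>The scaled element \<open>a / t\<close> has the form \<open>1 - x\<close> with \<open>norm x \<le> 1\<close>.\<close>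
    let ?x = "1 - (1/t) *\<^sub>R a"
    have "norm ?x = norm ((1/t) *\<^sub>R (t *\<^sub>R 1 - a))" using tp by (simp add: algebra_simps)
    also have "\<dots> \<le> 1" using t tp by (simp only: norm_scaleR) (simp add: field_simps)
    finally have nx: "norm ?x \<le> 1" .
    have sx: "star ?x = ?x" by (simp add: star_simps sa)
    obtain d where d: "star d = d" "d * d = 1 - ?x" "norm (1 - d) \<le> 1"
      "\<And>z. z * ?x = ?x * z \<Longrightarrow> z * d = d * z"
      using sqrt_one_minus_ex[OF nx sx] by metis
    let ?c = "sqrt t *\<^sub>R d"
    have "norm_pos ?c"
    proof (rule norm_posI)
      have "norm (sqrt t *\<^sub>R 1 - ?c) = norm (sqrt t *\<^sub>R (1 - d))" by (simp add: algebra_simps)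
      also have "\<dots> \<le> sqrt t" using d(3) t(1)
        by (simp only: norm_scaleR) (simp add: mult_left_le)
      finally show "norm (sqrt t *\<^sub>R 1 - ?c) \<le> sqrt t" .
    qed (simp add: star_simps d)
    then show ?thesis
    proof (rule that[rotated 2])
      show "star ?c = ?c" by (simp add: star_simps d(1))
      show "?c * ?c = a" using tp by (simp add: d(2) algebra_simps)
      show "z * ?c = ?c * z" if "z * a = a * z" for z
        using d(4)[of z] that by (simp add: algebra_simps)
    qed
  qed
qed

text \<open>
  After scaling to \<open>norm c \<le> 1\<close>, the element \<open>1 - c\<^sup>2\<close> has a self-adjoint root \<open>d\<close> that commutes with
  \<open>c\<close>. Since \<open>c\<^sup>2 + d\<^sup>2 = 1\<close>, the norm of \<open>d\<close> is at most \<open>1\<close>, and \<open>norm (1 - c\<^sup>2) = (norm d)\<^sup>2\<close>.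
\<close>

lemma norm_diff_square_le:
  fixes c :: "'a::{cstar_algebra,real_normed_algebra_1}"
  assumes sa: "star c = c" and t: "norm c \<le> t"
  shows "norm (t\<^sup>2 *\<^sub>R 1 - c * c) \<le> t\<^sup>2"
proof (cases "t = 0")
  case True
  then show ?thesis using t by simp
next
  case False
  then have tp: "t > 0" using t norm_ge_zero[of c] by linarith
  let ?b = "(1/t) *\<^sub>R c"
  have sb: "star ?b = ?b" by (simp add: star_simps sa)
  have nb: "norm ?b \<le> 1" using t tp by (simp add: field_simps)
  have nx: "norm (?b * ?b) \<le> 1"
    by (metis sb nb norm_square_selfadjoint norm_ge_zero power_le_one)
  have sx: "star (?b * ?b) = ?b * ?b" by (simp only: star_mult sb)
  obtain d where d: "star d = d" "d * d = 1 - ?b * ?b"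
      "\<And>z. z * (?b * ?b) = ?b * ?b * z \<Longrightarrow> z * d = d * z"
    using sqrt_one_minus_ex[OF nx sx] by metis
  have "?b * d = d * ?b" by (rule d(3)) (simp only: mult.assoc)
  then have "norm d \<le> 1"
    using norm_le_of_commuting_squares(2)[OF sb d(1), of 1] d(2) by (simp only:) simp
  then have "norm (1 - ?b * ?b) \<le> 1"
    using norm_square_selfadjoint[OF d(1)] d(2) by (simp add: power_le_one)
  moreover have "t\<^sup>2 *\<^sub>R 1 - c * c = t\<^sup>2 *\<^sub>R (1 - ?b * ?b)"
    using tp by (simp add: algebra_simps power2_eq_square)
  ultimately show ?thesis using tp by (simp only: norm_scaleR) (simp add: mult_left_le)
qed

lemma norm_pos_square: "star c = c \<Longrightarrow> norm_pos (c * c)"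
  by (rule norm_posI[OF _ norm_diff_square_le[OF _ order_refl]]) (simp_all add: star_mult)

text \<open>
  The bound \<open>t\<close> in the definition of positivity may be taken to be any number above the norm; this uniformity is
  what makes the cone closed.
\<close>

lemma norm_pos_bound:
  assumes "norm_pos a" "norm a \<le> t"
  shows "norm (t *\<^sub>R 1 - a) \<le> t"
proof -
  obtain c where c: "star c = c" "c * c = a" using norm_pos_sqrt[OF assms(1)] by metis
  have t: "t \<ge> 0" using assms(2) norm_ge_zero[of a] by linarith
  have "(norm c)\<^sup>2 \<le> t" using norm_square_selfadjoint[OF c(1)] c(2) assms(2) by simp
  then have "norm c \<le> sqrt t" by (simp add: real_le_rsqrt)
  from norm_diff_square_le[OF c(1) this] show ?thesis using t c(2) by simp
qed

lemma norm_pos_add: "norm_pos a \<Longrightarrow> norm_pos b \<Longrightarrow> norm_pos (a + b)"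
proof -
  assume a: "norm_pos a" and b: "norm_pos b"
  then obtain s t where st: "norm (s *\<^sub>R 1 - a) \<le> s" "norm (t *\<^sub>R 1 - b) \<le> t"
    by (auto simp: norm_pos_def)
  show ?thesis
  proof (rule norm_posI)
    show "star (a + b) = a + b" using a b by (simp add: norm_pos_def star_add)
    have "(s + t) *\<^sub>R 1 - (a + b) = (s *\<^sub>R 1 - a) + (t *\<^sub>R 1 - b)" by (simp add: algebra_simps)
    then show "norm ((s + t) *\<^sub>R 1 - (a + b)) \<le> s + t" using st norm_triangle_mono by metis
  qed
qed

lemma norm_pos_closed:
  assumes pos: "\<And>n. norm_pos (f n)" and lim: "f \<longlonglongrightarrow> a"
  shows "norm_pos a"
proof -
  have "Bseq f" using lim convergent_def convergent_imp_Bseq by blast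
  then obtain t where t: "\<And>n. norm (f n) \<le> t" by (meson BseqE)
  show ?thesis
  proof (rule norm_posI)
    show "star a = a"
      using tendsto_star[OF lim] lim pos by (simp add: norm_pos_def LIMSEQ_unique)
    have "(\<lambda>n. norm (t *\<^sub>R 1 - f n)) \<longlonglongrightarrow> norm (t *\<^sub>R 1 - a)" by (intro tendsto_intros lim)
    then show "norm (t *\<^sub>R 1 - a) \<le> t"
      by (rule LIMSEQ_le_const2) (use norm_pos_bound[OF pos t] in auto)
  qed
qed

text \<open>
  With commuting roots \<open>c\<^sup>2 = a\<close> and \<open>d\<^sup>2 = t - a\<close> one has \<open>c\<^sup>2 + d\<^sup>2 = t\<close>.
\<close>

lemma norm_le_of_norm_pos:
  assumes a: "norm_pos a" and ta: "norm_pos (t *\<^sub>R 1 - a)" and t: "t \<ge> 0"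
  shows "norm a \<le> t"
proof -
  obtain c where c: "star c = c" "c * c = a" using norm_pos_sqrt[OF a] by metis
  obtain d where d: "star d = d" "d * d = t *\<^sub>R 1 - a"
      "\<And>z. z * (t *\<^sub>R 1 - a) = (t *\<^sub>R 1 - a) * z \<Longrightarrow> z * d = d * z"
    using norm_pos_sqrt[OF ta] by metis
  have cd: "c * d = d * c" by (rule d(3)) (simp add: c(2)[symmetric] algebra_simps)
  have "norm (c * c + d * d) \<le> (sqrt t)\<^sup>2" using c(2) d(2) t by simp
  then have "norm c \<le> sqrt t" using norm_le_of_commuting_squares(1)[OF c(1) d(1) cd] t by simp
  then have "(norm c)\<^sup>2 \<le> t" using t power_mono[of "norm c" "sqrt t" 2] by simp
  then show ?thesis using norm_square_selfadjoint[OF c(1)] c(2) by simp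
qed

lemma norm_pos_antisym: "norm_pos a \<Longrightarrow> norm_pos (- a) \<Longrightarrow> a = 0"
  using norm_le_of_norm_pos[of a 0] by simp

lemma norm_pow2_selfadjoint:
  fixes w :: "'a::{cstar_algebra,real_normed_algebra_1}"
  assumes "star w = w"
  shows "star (w ^ n) = w ^ n" and "norm (w ^ (2 ^ m)) = norm w ^ (2 ^ m)"
proof -
  show s: "star (w ^ n) = w ^ n" for n
    by (induction n) (simp_all add: star_mult assms power_commutes)
  show "norm (w ^ (2 ^ m)) = norm w ^ (2 ^ m)"
  proof (induction m)
    case (Suc m)
    have "w ^ (2 ^ Suc m) = w ^ (2 ^ m) * w ^ (2 ^ m)" by (simp add: mult_2 power_add)
    then show ?case
      using norm_square_selfadjoint[OF s, of "2 ^ m"] Suc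
      by (simp add: power2_eq_square mult_2 power_add)
  qed simp
qed

text \<open>
  If \<open>r / t = 1 + e\<close> with \<open>e > 0\<close>, the square of the Bernoulli inequality makes \<open>(r / t)\<^bsup>2n\<^esup>\<close> grow at
  least quadratically in \<open>n\<close>, faster than \<open>2 n + 1\<close>.
\<close>

lemma le_of_pow2_growth:
  fixes r t :: real
  assumes t: "t > 0" and r: "\<And>m. r ^ (2 ^ m) \<le> (2 ^ m + 1) * t ^ (2 ^ m)"
  shows "r \<le> t"
proof (rule ccontr)
  assume "\<not> r \<le> t"
  define e where "e = r / t - 1"
  have e: "e > 0" using \<open>\<not> r \<le> t\<close> t by (simp add: e_def)
  obtain m :: nat where m: "2 / e\<^sup>2 < 2 ^ m" by (meson one_less_numeral_iff real_arch_pow semiring_norm(76))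
  have "1 + 2 ^ m * e \<le> (1 + e) ^ (2 ^ m)"
    using Bernoulli_inequality[of e "2 ^ m"] e by simp
  then have "(1 + 2 ^ m * e)\<^sup>2 \<le> ((1 + e) ^ (2 ^ m))\<^sup>2" using e by (intro power_mono) auto
  also have "\<dots> = (r / t) ^ (2 ^ Suc m)" by (simp add: e_def power_mult[symmetric] mult.commute)
  also have "\<dots> \<le> 2 ^ Suc m + 1" using r[of "Suc m"] t by (simp add: power_divide divide_le_eq)
  finally have "1 + 2 * 2 ^ m * e + 2 ^ m * 2 ^ m * e\<^sup>2 \<le> 2 * 2 ^ m + 1"
    by (simp add: power2_eq_square algebra_simps)
  moreover have "2 ^ m * (2 ^ m * e\<^sup>2) > 2 ^ m * 2"
    using m e by (intro mult_strict_left_mono) (auto simp: divide_less_eq)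
  moreover have "2 * 2 ^ m * e > 0" using e by simp
  ultimately show False by simp
qed

text \<open>
  Apart from \<open>0\<close> the spectra of \<open>e\<^sup>* e\<close> and \<open>e e\<^sup>*\<close> agree. Here this takes the form of a norm
  estimate: the powers of \<open>w = t + e e\<^sup>*\<close> differ from \<open>t\<^sup>n\<close> by \<open>e q e\<^sup>*\<close> with \<open>q\<close> a polynomial in
  \<open>v = t + e\<^sup>* e\<close>, and \<open>norm v \<le> t\<close> bounds \<open>q\<close>. So \<open>norm (w\<^sup>n)\<close> exceeds \<open>t\<^sup>n\<close> by a factor \<open>n + 1\<close> at most,
  which forces \<open>norm w \<le> t\<close>.
\<close>

lemma norm_pos_minus_swap:
  fixes e :: "'a::{cstar_algebra,real_normed_algebra_1}"
  assumes "norm_pos (- (star e * e))"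
  shows "norm_pos (- (e * star e))"
proof (cases "e = 0")
  case True
  then show ?thesis using assms by simp
next
  case False
  define t where "t = (norm e)\<^sup>2"
  have t: "t > 0" using False by (simp add: t_def)
  define v where "v = t *\<^sub>R 1 + star e * e"
  define w where "w = t *\<^sub>R 1 + e * star e"
  have nv: "norm v \<le> t"
    using norm_pos_bound[OF assms, of t] by (simp add: v_def t_def norm_star_mult)
  have we: "w * e = e * v" by (simp add: v_def w_def algebra_simps)
  have ex: "\<exists>q. w ^ n = (t ^ n) *\<^sub>R 1 + e * q * star e \<and> t * norm q \<le> n * t ^ n" for n
  proof (induction n)
    case 0
    show ?case by (intro exI[of _ 0]) simp
  next
    case (Suc n)
    then obtain q where q: "w ^ n = (t ^ n) *\<^sub>R 1 + e * q * star e" "t * norm q \<le> n * t ^ n"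
      by auto
    let ?q = "(t ^ n) *\<^sub>R 1 + v * q"
    have "w ^ Suc n = (t ^ n) *\<^sub>R w + (w * e) * q * star e"
      by (simp add: q(1) algebra_simps)
    also have "\<dots> = (t ^ Suc n) *\<^sub>R 1 + e * ?q * star e"
      by (simp add: we) (simp add: w_def algebra_simps)
    finally have 1: "w ^ Suc n = (t ^ Suc n) *\<^sub>R 1 + e * ?q * star e" .
    have "norm ?q \<le> t ^ n + norm v * norm q"
      using norm_triangle_ineq[of "(t ^ n) *\<^sub>R 1" "v * q"] norm_mult_ineq[of v q] t by simp
    also have "\<dots> \<le> t ^ n + t * norm q" using nv by (simp add: mult_right_mono)
    also have "\<dots> \<le> t ^ n + n * t ^ n" using q(2) by simp
    finally have "t * norm ?q \<le> t * (t ^ n + n * t ^ n)" using t by simp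
    then have "t * norm ?q \<le> Suc n * t ^ Suc n" by (simp add: algebra_simps)
    with 1 show ?case by blast
  qed
  have sw: "star w = w" by (simp add: w_def star_simps)
  have "norm w ^ (2 ^ m) \<le> (2 ^ m + 1) * t ^ (2 ^ m)" for m
  proof -
    obtain q where q: "w ^ (2 ^ m) = (t ^ (2 ^ m)) *\<^sub>R 1 + e * q * star e"
        "t * norm q \<le> real (2 ^ m) * t ^ (2 ^ m)"
      using ex by blast
    have "norm (e * q * star e) \<le> norm e * norm q * norm (star e)"
      by (meson norm_mult_ineq mult_right_mono norm_ge_zero order_trans)
    also have "\<dots> = t * norm q" by (simp add: t_def power2_eq_square)
    finally have "norm (w ^ (2 ^ m)) \<le> t ^ (2 ^ m) + t * norm q"
      using norm_triangle_ineq[of "(t ^ (2 ^ m)) *\<^sub>R (1::'a)" "e * q * star e"] t q(1) by simp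
    then show ?thesis using q(2) norm_pow2_selfadjoint(2)[OF sw] by (simp add: algebra_simps)
  qed
  then have "norm w \<le> t" by (rule le_of_pow2_growth[OF t])
  then show ?thesis by (intro norm_posI[of _ t]) (auto simp: star_simps w_def)
qed

text \<open>
  With \<open>e = a + \<i> b\<close> for self-adjoint \<open>a\<close> and \<open>b\<close>, the sum is \<open>2 a\<^sup>2 + 2 b\<^sup>2\<close>.
\<close>

lemma norm_pos_star_add_swap: "norm_pos (star e * e + e * star e)"
proof -
  define x where "x = (1 / sqrt 2) *\<^sub>R (e + star e)"
  define z where "z = \<i> *\<^sub>C (e - star e)"
  define y where "y = (1 / sqrt 2) *\<^sub>R z"
  have half: "1 / sqrt 2 * (1 / sqrt 2) = (1/2 :: real)" by (simp add: field_simps)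
  have "x * x = (1/2) *\<^sub>R ((e + star e) * (e + star e))"
    unfolding x_def mult_scaleR_left mult_scaleR_right scaleR_scaleR half ..
  moreover have "y * y = (1/2) *\<^sub>R (z * z)"
    unfolding y_def mult_scaleR_left mult_scaleR_right scaleR_scaleR half ..
  moreover have "z * z = - ((e - star e) * (e - star e))"
    unfolding z_def scaleC_mult_left scaleC_mult_right scaleC_scaleC
    by (simp add: minus_one_scaleC)
  ultimately have "x * x + y * y
      = (1/2) *\<^sub>R ((e + star e) * (e + star e) - (e - star e) * (e - star e))"
    by (simp only: scaleR_add_right[symmetric]) simp
  also have "\<dots> = (1/2) *\<^sub>R (2 *\<^sub>R (star e * e + e * star e))"
    unfolding scaleR_2 by (simp add: algebra_simps)
  also have "\<dots> = star e * e + e * star e" by simp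
  finally have "x * x + y * y = star e * e + e * star e" .
  moreover have "star x = x" "star y = y"
    by (simp_all add: x_def y_def z_def star_simps scaleC_minus_left scaleC_diff_right add.commute)
  ultimately show ?thesis by (metis norm_pos_add norm_pos_square)
qed

text \<open>
  Let \<open>h = b\<^sup>* b\<close>, let \<open>p\<close> be the absolute value of \<open>h\<close>, and let \<open>n = p - h\<close>, twice the negative part of
  \<open>h\<close>. Then \<open>e = b n\<close> satisfies \<open>e\<^sup>* e = n h n = - p n\<^sup>2 \<le> 0\<close>, hence also \<open>e e\<^sup>* \<le> 0\<close>. But
  \<open>e\<^sup>* e + e e\<^sup>* \<ge> 0\<close>, so that \<open>e\<^sup>* e\<close> is both positive and negative and vanishes. This makes \<open>n\<close>
  zero.
\<close>

theorem norm_pos_star_mult: "norm_pos (star b * b)"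
proof -
  define h where "h = star b * b"
  have sh: "star h = h" by (simp add: h_def star_simps)
  obtain p where p: "star p = p" "p * p = h * h" "norm_pos p"
      "\<And>z. z * (h * h) = h * h * z \<Longrightarrow> z * p = p * z"
    using norm_pos_sqrt[OF norm_pos_square[OF sh]] by metis
  have hp: "h * p = p * h" by (rule p(4)) (simp add: mult.assoc)
  obtain r where r: "star r = r" "r * r = p" "\<And>z. z * p = p * z \<Longrightarrow> z * r = r * z"
    using norm_pos_sqrt[OF p(3)] by metis
  define n where "n = p - h"
  have sn: "star n = n" by (simp add: n_def star_simps p sh)
  have "n * p = p * n" by (simp add: n_def algebra_simps hp)
  then have nr: "n * r = r * n" by (rule r(3))
  have hn: "h * n = - (p * n)" by (simp add: n_def algebra_simps hp p(2))
  have nn: "n * n = 2 *\<^sub>R (p * n)" by (simp add: n_def algebra_simps hp p(2) scaleR_2)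
  define e where "e = b * n"
  have "star e * e = n * (h * n)" by (simp add: e_def star_simps sn h_def mult.assoc)
  also have "\<dots> = - (n * r * (r * n))" by (simp add: hn r(2)[symmetric] mult.assoc)
  finally have ee: "star e * e = - ((r * n) * (r * n))" by (simp add: nr)
  have srn: "star (r * n) = r * n" by (simp add: star_simps sn r nr)
  have neg: "norm_pos (- (star e * e))" using ee norm_pos_square[OF srn] by simp
  then have "norm_pos (- (e * star e))" by (rule norm_pos_minus_swap)
  then have "norm_pos (star e * e)" using norm_pos_add norm_pos_star_add_swap[of e] by fastforce
  then have "star e * e = 0" using neg norm_pos_antisym by blast
  then have "norm (r * n) = 0" using ee norm_square_selfadjoint[OF srn] by simp
  then have "p * n = 0" by (simp add: r(2)[symmetric] mult.assoc)
  then have "norm n = 0" using nn norm_square_selfadjoint[OF sn] by simp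
  then have "h = p" by (simp add: n_def)
  then show ?thesis using p(3) h_def by simp
qed

section \<open>Unitization\<close>

text \<open>
  The formal elements \<open>a + \<lambda> 1\<close>. The norm is the maximum of the operator norm of left multiplication on
  the algebra and the modulus of \<open>\<lambda>\<close>. Left multiplication alone gives only a seminorm if the algebra
  already has a unit \<open>e\<close>, because it kills \<open>e - 1\<close>; the maximum with the character \<open>\<lambda>\<close> is a
  \<open>C\<^sup>*\<close>-norm in every case.
\<close>

datatype 'a unitization = Adjoin (alg_part: 'a) (scalar_part: complex)

lemma unitization_eq_iff:
  "u = v \<longleftrightarrow> alg_part u = alg_part v \<and> scalar_part u = scalar_part v"
  by (cases u; cases v) auto

definition left_mult :: "'a::cstar_algebra unitization \<Rightarrow> 'a \<Rightarrow> 'a" where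
  "left_mult u x = alg_part u * x + scalar_part u *\<^sub>C x"

instantiation unitization :: (cstar_algebra) complex_vector
begin
definition "0 = Adjoin 0 0"
definition "u + v = Adjoin (alg_part u + alg_part v) (scalar_part u + scalar_part v)"
definition "- u = Adjoin (- alg_part u) (- scalar_part u)"
definition "u - v = Adjoin (alg_part u - alg_part v) (scalar_part u - scalar_part v)"
definition "scaleC c u = Adjoin (c *\<^sub>C alg_part u) (c * scalar_part u)"
instance
  by standard (simp_all add: unitization_eq_iff zero_unitization_def plus_unitization_def
      uminus_unitization_def minus_unitization_def scaleC_unitization_def scaleC_add_right
      scaleC_add_left scaleC_scaleC scaleC_one algebra_simps)
end

instantiation unitization :: (cstar_algebra) real_normed_algebra_1
begin
definition "1 = Adjoin 0 1"
definition "u * v = Adjoin (alg_part u * alg_part v + scalar_part u *\<^sub>C alg_part v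
    + scalar_part v *\<^sub>C alg_part u) (scalar_part u * scalar_part v)"
definition "scaleR r u = complex_of_real r *\<^sub>C (u :: 'a unitization)"
definition "norm u = max (onorm (left_mult u)) (cmod (scalar_part u))"
definition "dist u v = norm (u - v :: 'a unitization)"
definition "sgn u = inverse (norm u) *\<^sub>R (u :: 'a unitization)"
definition [code del]: "uniformity = (INF e\<in>{0<..}. principal {(x, y :: 'a unitization). dist x y < e})"
definition [code del]: "open S \<longleftrightarrow> (\<forall>x\<in>S. \<forall>\<^sub>F (x', y) in uniformity. x' = x \<longrightarrow> y \<in> (S :: 'a unitization set))"

lemma bounded_linear_left_mult: "bounded_linear (left_mult (u :: 'a unitization))"
proof (rule bounded_linear_intro[of _ "norm (alg_part u) + cmod (scalar_part u)"])
  show "norm (left_mult u x) \<le> norm x * (norm (alg_part u) + cmod (scalar_part u))" for x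
    unfolding left_mult_def distrib_left
    by (intro norm_triangle_mono) (metis norm_mult_ineq mult.commute, simp add: norm_scaleC mult.commute)
qed (simp_all add: left_mult_def scaleC_add_right scaleR_eq_scaleC scaleC_scaleC
    scaleC_mult_right algebra_simps)

lemma onorm_left_mult_nonneg: "0 \<le> onorm (left_mult (u :: 'a unitization))"
  by (rule onorm_pos_le[OF bounded_linear_left_mult])

lemma left_mult_mult: "left_mult (u * v) = left_mult u \<circ> left_mult (v :: 'a unitization)"
  by (rule ext) (simp add: left_mult_def times_unitization_def scaleC_add_right scaleC_scaleC
      scaleC_mult_left scaleC_mult_right algebra_simps)

lemma onorm_left_mult_embed: "onorm (left_mult (Adjoin a 0)) = norm (a :: 'a)"
proof (rule antisym)
  show "onorm (left_mult (Adjoin a 0)) \<le> norm a"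
    by (rule onorm_bound) (simp_all add: left_mult_def norm_mult_ineq)
  have "norm a * norm a = norm (left_mult (Adjoin a 0) (star a))"
    using norm_star_mult[of "star a"] by (simp add: left_mult_def star_star power2_eq_square)
  also have "\<dots> \<le> onorm (left_mult (Adjoin a 0)) * norm a"
    using onorm[OF bounded_linear_left_mult, of "Adjoin a 0" "star a"] by simp
  finally show "norm a \<le> onorm (left_mult (Adjoin a 0))"
    using onorm_left_mult_nonneg[of "Adjoin a 0"] by (cases "a = 0") auto
qed

instance
proof
  fix u v w :: "'a unitization" and r s :: real
  show "dist u v = norm (u - v)" by (rule dist_unitization_def)
  show "sgn u = inverse (norm u) *\<^sub>R u" by (rule sgn_unitization_def)
  show "uniformity = (INF e\<in>{0<..}. principal {(x, y :: 'a unitization). dist x y < e})"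
    by (rule uniformity_unitization_def)
  show "open S \<longleftrightarrow> (\<forall>x\<in>S. \<forall>\<^sub>F (x', y) in uniformity. x' = x \<longrightarrow> y \<in> S)"
    for S :: "'a unitization set" by (rule open_unitization_def)
  show "r *\<^sub>R (u + v) = r *\<^sub>R u + r *\<^sub>R v" "(r + s) *\<^sub>R u = r *\<^sub>R u + s *\<^sub>R u"
    "r *\<^sub>R s *\<^sub>R u = (r * s) *\<^sub>R u" "1 *\<^sub>R u = u"
    by (simp_all add: scaleR_unitization_def scaleC_add_right scaleC_add_left scaleC_scaleC scaleC_one)
  show "u * v * w = u * (v * w)" "(u + v) * w = u * w + v * w" "u * (v + w) = u * v + u * w"
    "1 * u = u" "u * 1 = u" "(0::'a unitization) \<noteq> 1"
    "r *\<^sub>R u * v = r *\<^sub>R (u * v)" "u * r *\<^sub>R v = r *\<^sub>R (u * v)"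
    by (simp_all add: unitization_eq_iff times_unitization_def one_unitization_def
        zero_unitization_def plus_unitization_def scaleR_unitization_def scaleC_unitization_def
        scaleC_add_right scaleC_add_left scaleC_scaleC scaleC_mult_left scaleC_mult_right
        scaleC_one algebra_simps)
  have "left_mult (1 :: 'a unitization) = id"
    by (rule ext) (simp add: left_mult_def one_unitization_def scaleC_one)
  then have "onorm (left_mult (1 :: 'a unitization)) \<le> 1"
    by (intro onorm_bound) auto
  then show "norm (1 :: 'a unitization) = 1"
    by (simp add: norm_unitization_def one_unitization_def[symmetric] max_def)
      (simp add: one_unitization_def)
  show "(norm u = 0) = (u = 0)"
  proof
    assume 0: "norm u = 0"
    have "cmod (scalar_part u) \<le> norm u" "onorm (left_mult u) \<le> norm u"
      by (simp_all add: norm_unitization_def)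
    then have s: "scalar_part u = 0" and o: "onorm (left_mult u) \<le> 0" using 0 by auto
    have "u = Adjoin (alg_part u) 0" using s by (simp add: unitization_eq_iff)
    then have "norm (alg_part u) \<le> 0" using o onorm_left_mult_embed by metis
    then show "u = 0" using s by (simp add: unitization_eq_iff zero_unitization_def)
  next
    assume "u = 0"
    moreover have "left_mult (0 :: 'a unitization) = (\<lambda>x. 0)"
      by (rule ext) (simp add: left_mult_def zero_unitization_def)
    ultimately show "norm u = 0"
      by (simp add: norm_unitization_def onorm_zero) (simp add: zero_unitization_def)
  qed
  show "norm (u + v) \<le> norm u + norm v"
  proof -
    have "left_mult (u + v) = (\<lambda>x. left_mult u x + left_mult v x)"
      by (rule ext) (simp add: left_mult_def plus_unitization_def scaleC_add_left algebra_simps)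
    then have "onorm (left_mult (u + v)) \<le> onorm (left_mult u) + onorm (left_mult v)"
      using onorm_triangle[OF bounded_linear_left_mult bounded_linear_left_mult] by metis
    moreover have "cmod (scalar_part (u + v)) \<le> cmod (scalar_part u) + cmod (scalar_part v)"
      by (simp add: plus_unitization_def norm_triangle_ineq)
    ultimately show ?thesis unfolding norm_unitization_def by linarith
  qed
  show "norm (r *\<^sub>R u) = \<bar>r\<bar> * norm u"
  proof -
    have "left_mult (r *\<^sub>R u) = (\<lambda>x. r *\<^sub>R left_mult u x)"
      by (rule ext) (simp add: left_mult_def scaleR_unitization_def scaleC_unitization_def
          scaleC_mult_left scaleC_scaleC scaleR_eq_scaleC scaleC_add_right)
    then have "onorm (left_mult (r *\<^sub>R u)) = \<bar>r\<bar> * onorm (left_mult u)"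
      using onorm_scaleR[OF bounded_linear_left_mult] by metis
    moreover have "cmod (scalar_part (r *\<^sub>R u)) = \<bar>r\<bar> * cmod (scalar_part u)"
      by (simp add: scaleR_unitization_def scaleC_unitization_def norm_mult)
    ultimately show ?thesis unfolding norm_unitization_def by (simp add: max_mult_distrib_left)
  qed
  show "norm (u * v) \<le> norm u * norm v"
  proof -
    have "onorm (left_mult (u * v)) \<le> onorm (left_mult u) * onorm (left_mult v)"
      unfolding left_mult_mult by (intro onorm_compose bounded_linear_left_mult)
    also have "\<dots> \<le> norm u * norm v" unfolding norm_unitization_def
      by (intro mult_mono) (auto simp: onorm_left_mult_nonneg max.coboundedI2)
    finally have 1: "onorm (left_mult (u * v)) \<le> norm u * norm v" .
    have "cmod (scalar_part (u * v)) = cmod (scalar_part u) * cmod (scalar_part v)"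
      by (simp add: times_unitization_def norm_mult)
    also have "\<dots> \<le> norm u * norm v" unfolding norm_unitization_def
      by (intro mult_mono) (auto simp: max.coboundedI2)
    finally show ?thesis using 1 by (subst norm_unitization_def) simp
  qed
qed
end

lemma norm_embed [simp]: "norm (Adjoin a 0) = norm (a::'a::cstar_algebra)"
  by (simp add: norm_unitization_def onorm_left_mult_embed)

lemma cmod_scalar_part_le: "cmod (scalar_part u) \<le> norm (u::'a::cstar_algebra unitization)"
  by (simp add: norm_unitization_def)

lemma norm_unitization_le:
  "norm (u::'a::cstar_algebra unitization) \<le> norm (alg_part u) + cmod (scalar_part u)"
proof -
  have u: "u = Adjoin (alg_part u) 0 + scalar_part u *\<^sub>C 1"
    by (simp add: unitization_eq_iff plus_unitization_def scaleC_unitization_def one_unitization_def)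
  have "left_mult (scalar_part u *\<^sub>C 1) = (\<lambda>x. scalar_part u *\<^sub>C (x::'a))"
    by (rule ext) (simp add: left_mult_def scaleC_unitization_def one_unitization_def)
  then have "onorm (left_mult (scalar_part u *\<^sub>C (1::'a unitization))) \<le> cmod (scalar_part u)"
    by (intro onorm_bound) (auto simp: norm_scaleC)
  then have "norm (scalar_part u *\<^sub>C (1::'a unitization)) \<le> cmod (scalar_part u)"
    by (simp add: norm_unitization_def) (simp add: scaleC_unitization_def one_unitization_def)
  then show ?thesis using norm_triangle_ineq[of "Adjoin (alg_part u) 0" "scalar_part u *\<^sub>C 1"]
    by (simp add: u[symmetric])
qed

text \<open>
  The projection to the algebra is bounded, so that a Cauchy sequence in the unitization converges in
  both components.
\<close>

lemma norm_alg_part_le: "norm (alg_part u) \<le> 2 * norm (u::'a::cstar_algebra unitization)"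
proof -
  have u: "Adjoin (alg_part u) 0 = u - Adjoin 0 (scalar_part u)"
    by (simp add: unitization_eq_iff minus_unitization_def)
  have "norm (alg_part u) \<le> norm u + norm (Adjoin 0 (scalar_part u) :: 'a unitization)"
    using norm_triangle_ineq4[of u "Adjoin 0 (scalar_part u)"] by (simp add: u[symmetric])
  also have "norm (Adjoin 0 (scalar_part u) :: 'a unitization) \<le> cmod (scalar_part u)"
    using norm_unitization_le[of "Adjoin 0 (scalar_part u) :: 'a unitization"] by simp
  finally show ?thesis using cmod_scalar_part_le[of u] by simp
qed

instantiation unitization :: (cstar_algebra) cstar_algebra
begin
definition "star u = Adjoin (star (alg_part u)) (cnj (scalar_part u))"

text \<open>
  For \<open>y = u x\<close> one has \<open>y\<^sup>* y = x\<^sup>* (u\<^sup>* u x)\<close>; this is the usual proof that operators on a Hilbert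
  space satisfy the \<open>C\<^sup>*\<close>-identity, with the algebra in the role of the space.
\<close>

lemma onorm_left_mult_cstar:
  "(onorm (left_mult u))\<^sup>2 \<le> onorm (left_mult (star u * (u :: 'a unitization)))"
proof -
  let ?N = "onorm (left_mult (star u * u))"
  have N: "?N \<ge> 0" by (rule onorm_pos_le[OF bounded_linear_left_mult])
  have "norm (left_mult u x) \<le> sqrt ?N * norm x" for x
  proof (rule power2_le_imp_le)
    have "(norm (left_mult u x))\<^sup>2 = norm (star (left_mult u x) * left_mult u x)"
      by (simp add: norm_star_mult)
    also have "star (left_mult u x) * left_mult u x = star x * left_mult (star u * u) x"
      by (simp add: left_mult_def star_unitization_def times_unitization_def star_simps
          scaleC_add_right scaleC_scaleC scaleC_mult_left scaleC_mult_right algebra_simps)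
    also have "norm \<dots> \<le> norm (star x) * norm (left_mult (star u * u) x)" by (rule norm_mult_ineq)
    also have "\<dots> \<le> norm x * (?N * norm x)"
      using onorm[OF bounded_linear_left_mult] by (intro mult_mono) auto
    finally show "(norm (left_mult u x))\<^sup>2 \<le> (sqrt ?N * norm x)\<^sup>2"
      using N by (simp add: power_mult_distrib power2_eq_square algebra_simps)
  qed (simp add: N)
  then have "onorm (left_mult u) \<le> sqrt ?N" by (intro onorm_bound) (simp_all add: N)
  then have "(onorm (left_mult u))\<^sup>2 \<le> (sqrt ?N)\<^sup>2"
    using onorm_pos_le[OF bounded_linear_left_mult] by (intro power_mono)
  then show ?thesis using N by simp
qed

lemma onorm_left_mult_star_le:
  "onorm (left_mult u) \<le> onorm (left_mult (star (u :: 'a unitization)))"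
proof (cases "onorm (left_mult u) = 0")
  case True
  then show ?thesis using onorm_pos_le[OF bounded_linear_left_mult] by simp
next
  case False
  have "onorm (left_mult (star u * u)) \<le> onorm (left_mult (star u)) * onorm (left_mult u)"
    unfolding left_mult_mult by (intro onorm_compose bounded_linear_left_mult)
  then have "onorm (left_mult u) * onorm (left_mult u)
      \<le> onorm (left_mult (star u)) * onorm (left_mult u)"
    using onorm_left_mult_cstar[of u] unfolding power2_eq_square by linarith
  moreover have "onorm (left_mult u) > 0"
    using False onorm_pos_le[OF bounded_linear_left_mult, of u] by simp
  ultimately show ?thesis by simp
qed

instance
proof
  fix u v :: "'a unitization" and c :: complex and r :: real
  show ss: "star (star w) = w" for w :: "'a unitization"
    by (simp add: star_unitization_def star_star unitization_eq_iff)
  show "r *\<^sub>R u = complex_of_real r *\<^sub>C u" by (rule scaleR_unitization_def)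
  show "(c *\<^sub>C u) * v = c *\<^sub>C (u * v)" "u * (c *\<^sub>C v) = c *\<^sub>C (u * v)"
    "star (u + v) = star u + star v" "star (c *\<^sub>C u) = cnj c *\<^sub>C star u"
    "star (u * v) = star v * star u"
    by (simp_all add: unitization_eq_iff times_unitization_def star_unitization_def
        plus_unitization_def scaleC_unitization_def star_simps
        scaleC_add_right scaleC_add_left scaleC_scaleC scaleC_mult_left scaleC_mult_right
        algebra_simps)
  show "norm (c *\<^sub>C u) = cmod c * norm u"
  proof -
    have le: "norm (d *\<^sub>C w) \<le> cmod d * norm w" for d and w :: "'a unitization"
    proof -
      have "norm (left_mult (d *\<^sub>C w) x) \<le> cmod d * onorm (left_mult w) * norm x" for x
      proof -
        have "left_mult (d *\<^sub>C w) x = d *\<^sub>C left_mult w x"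
          by (simp add: left_mult_def scaleC_unitization_def scaleC_mult_left scaleC_scaleC
              scaleC_add_right)
        then show ?thesis
          using mult_left_mono[OF onorm[OF bounded_linear_left_mult, of w x], of "cmod d"]
          by (simp add: norm_scaleC mult.assoc)
      qed
      then have "onorm (left_mult (d *\<^sub>C w)) \<le> cmod d * onorm (left_mult w)"
        by (intro onorm_bound mult_nonneg_nonneg) (simp_all add: onorm_pos_le[OF bounded_linear_left_mult])
      moreover have "cmod (scalar_part (d *\<^sub>C w)) = cmod d * cmod (scalar_part w)"
        by (simp add: scaleC_unitization_def norm_mult)
      ultimately show ?thesis unfolding norm_unitization_def by (simp add: max_mult_distrib_left)
    qed
    show ?thesis
    proof (cases "c = 0")
      case False
      have "norm u = norm (inverse c *\<^sub>C c *\<^sub>C u)" using False by (simp add: scaleC_scaleC scaleC_one)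
      also have "\<dots> \<le> inverse (cmod c) * norm (c *\<^sub>C u)" using le by (metis norm_inverse)
      finally have "cmod c * norm u \<le> norm (c *\<^sub>C u)" using False by (simp add: field_simps)
      then show ?thesis using le[of c u] by simp
    qed simp
  qed
  show "norm (star u * u) = (norm u)\<^sup>2"
  proof -
    have "onorm (left_mult (star u * u)) \<le> onorm (left_mult (star u)) * onorm (left_mult u)"
      unfolding left_mult_mult by (intro onorm_compose bounded_linear_left_mult)
    moreover have "onorm (left_mult (star u)) = onorm (left_mult u)"
      using onorm_left_mult_star_le[of u] onorm_left_mult_star_le[of "star u"] by (simp add: ss)
    ultimately have o: "onorm (left_mult (star u * u)) = (onorm (left_mult u))\<^sup>2"
      using onorm_left_mult_cstar[of u] by (simp add: power2_eq_square)
    have s: "cmod (scalar_part (star u * u)) = (cmod (scalar_part u))\<^sup>2"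
      by (simp add: times_unitization_def star_unitization_def norm_mult power2_eq_square)
    have "max (a\<^sup>2) (b\<^sup>2) = (max a b)\<^sup>2" if "a \<ge> 0" "b \<ge> 0" for a b :: real
      using that by (simp add: max_def power2_le_iff_abs_le abs_le_square_iff[symmetric])
    then show ?thesis unfolding norm_unitization_def o s
      by (simp add: onorm_pos_le[OF bounded_linear_left_mult])
  qed
next
  fix X :: "nat \<Rightarrow> 'a unitization"
  assume C: "Cauchy X"
  have "Cauchy (\<lambda>n. scalar_part (X n))"
    unfolding Cauchy_iff
  proof (intro allI impI)
    fix e :: real assume "e > 0"
    then obtain M where "\<forall>m\<ge>M. \<forall>n\<ge>M. norm (X m - X n) < e" using C unfolding Cauchy_iff by blast
    moreover have "norm (scalar_part (X m) - scalar_part (X n)) \<le> norm (X m - X n)" for m n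
      using cmod_scalar_part_le[of "X m - X n"] by (simp add: minus_unitization_def)
    ultimately show "\<exists>M. \<forall>m\<ge>M. \<forall>n\<ge>M. norm (scalar_part (X m) - scalar_part (X n)) < e"
      using order_le_less_trans by blast
  qed
  moreover have "Cauchy (\<lambda>n. alg_part (X n))"
    unfolding Cauchy_iff
  proof (intro allI impI)
    fix e :: real assume "e > 0"
    then obtain M where M: "\<forall>m\<ge>M. \<forall>n\<ge>M. norm (X m - X n) < e / 2"
      using C half_gt_zero unfolding Cauchy_iff by blast
    have le: "norm (alg_part (X m) - alg_part (X n)) \<le> 2 * norm (X m - X n)" for m n
      using norm_alg_part_le[of "X m - X n"] by (simp add: minus_unitization_def)
    have "norm (alg_part (X m) - alg_part (X n)) < e" if "m \<ge> M" "n \<ge> M" for m n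
      using le[of m n] M[rule_format, OF that] by linarith
    then show "\<exists>M. \<forall>m\<ge>M. \<forall>n\<ge>M. norm (alg_part (X m) - alg_part (X n)) < e" by blast
  qed
  ultimately obtain a l where "(\<lambda>n. alg_part (X n)) \<longlonglongrightarrow> a" "(\<lambda>n. scalar_part (X n)) \<longlonglongrightarrow> l"
    by (meson Cauchy_convergent convergent_def)
  then have lim: "(\<lambda>n. norm (alg_part (X n) - a) + cmod (scalar_part (X n) - l)) \<longlonglongrightarrow> 0"
    by (auto intro!: tendsto_eq_intros simp: tendsto_norm_zero_iff LIM_zero_iff)
  have "norm (X n - Adjoin a l)
      \<le> norm (norm (alg_part (X n) - a) + cmod (scalar_part (X n) - l)) * 1" for n
    using norm_unitization_le[of "X n - Adjoin a l"] by (simp add: minus_unitization_def)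
  then have "(\<lambda>n. X n - Adjoin a l) \<longlonglongrightarrow> 0"
    by (intro tendsto_0_le[OF lim, of _ 1]) (rule always_eventually, blast)
  then show "convergent X" unfolding convergent_def by (metis LIM_zero_iff)
qed
end

section \<open>Order in a possibly non-unital algebra\<close>

lemma embed_hom:
  fixes a b :: "'a::cstar_algebra"
  shows "Adjoin a 0 * Adjoin b 0 = Adjoin (a * b) 0" and "Adjoin a 0 + Adjoin b 0 = Adjoin (a + b) 0"
    and "Adjoin a 0 - Adjoin b 0 = Adjoin (a - b) 0" and "star (Adjoin a 0) = Adjoin (star a) 0"
    and "r *\<^sub>R Adjoin a 0 = Adjoin (r *\<^sub>R a) 0"
  by (simp_all add: times_unitization_def plus_unitization_def minus_unitization_def
      star_unitization_def uminus_unitization_def scaleR_unitization_def scaleC_unitization_def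
      scaleR_eq_scaleC)

text \<open>
  A self-adjoint root of an element of the algebra lies in the algebra, because its scalar part
  squares to zero.
\<close>

lemma cstar_pos_iff_norm_pos: "cstar_pos a \<longleftrightarrow> norm_pos (Adjoin (a::'a::cstar_algebra) 0)"
proof
  assume "cstar_pos a"
  then show "norm_pos (Adjoin a 0)"
    unfolding cstar_pos_def by (metis embed_hom(1,4) norm_pos_star_mult)
next
  assume "norm_pos (Adjoin a 0)"
  then obtain c where c: "star c = c" "c * c = Adjoin a 0" using norm_pos_sqrt by blast
  have "scalar_part c * scalar_part c = 0"
    using arg_cong[OF c(2), of scalar_part] by (simp add: times_unitization_def)
  then have "c = Adjoin (alg_part c) 0" by (simp add: unitization_eq_iff)
  then have "star (alg_part c) * alg_part c = a"
    using c by (metis embed_hom(1,4) unitization.inject)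
  then show "cstar_pos a" unfolding cstar_pos_def by metis
qed

lemma cstar_pos_add: "cstar_pos a \<Longrightarrow> cstar_pos b \<Longrightarrow> cstar_pos (a + b)"
  unfolding cstar_pos_iff_norm_pos embed_hom(2)[symmetric] by (rule norm_pos_add)

lemma cstar_pos_scaleR: "cstar_pos a \<Longrightarrow> 0 \<le> r \<Longrightarrow> cstar_pos (r *\<^sub>R a)"
proof -
  assume "cstar_pos a" "0 \<le> r"
  then obtain b where "a = star b * b" by (auto simp: cstar_pos_def)
  then have "r *\<^sub>R a = star (sqrt r *\<^sub>R b) * (sqrt r *\<^sub>R b)"
    using \<open>0 \<le> r\<close> by (simp add: star_simps)
  then show ?thesis unfolding cstar_pos_def by blast
qed

lemma cstar_pos_closed:
  fixes f :: "nat \<Rightarrow> 'a::cstar_algebra"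
  assumes "\<And>n. cstar_pos (f n)" "f \<longlonglongrightarrow> a"
  shows "cstar_pos a"
  unfolding cstar_pos_iff_norm_pos
proof (rule norm_pos_closed)
  show "norm_pos (Adjoin (f n) 0)" for n using assms(1) by (simp add: cstar_pos_iff_norm_pos)
  have "(\<lambda>n. norm (Adjoin (f n) 0 - Adjoin a 0)) \<longlonglongrightarrow> 0"
    using assms(2) by (simp add: embed_hom LIM_zero tendsto_norm_zero)
  then show "(\<lambda>n. Adjoin (f n) 0) \<longlonglongrightarrow> Adjoin a 0"
    using LIM_zero_iff tendsto_norm_zero_iff by blast
qed

lemma norm_pos_norm_minus: "norm_pos a \<Longrightarrow> norm_pos (norm a *\<^sub>R 1 - a)"
  by (rule norm_posI[of _ "norm a"]) (auto simp: norm_pos_def star_simps)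

lemma cstar_pos_norm_mono:
  fixes a b :: "'a::cstar_algebra"
  assumes "cstar_pos a" "cstar_pos (b - a)"
  shows "norm a \<le> norm b"
proof -
  let ?a = "Adjoin a 0" and ?b = "Adjoin b 0"
  have a: "norm_pos ?a" and ba: "norm_pos (?b - ?a)"
    using assms by (simp_all add: cstar_pos_iff_norm_pos embed_hom)
  have "norm_pos ?b" using norm_pos_add[OF a ba] by simp
  then have "norm_pos (norm b *\<^sub>R 1 - ?b)" using norm_pos_norm_minus by fastforce
  from norm_pos_add[OF this ba] have "norm_pos (norm b *\<^sub>R 1 - ?a)" by simp
  from norm_le_of_norm_pos[OF a this] show ?thesis by simp
qed

text \<open>
  In the unitization \<open>norm c - c = d\<^sup>2\<close> with \<open>d\<close> self-adjoint, and \<open>x\<^sup>* d\<^sup>2 x = (d x)\<^sup>* (d x)\<close>.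
\<close>

lemma cstar_pos_conj_le:
  fixes c x :: "'a::cstar_algebra"
  assumes "cstar_pos c"
  shows "cstar_pos (norm c *\<^sub>R (star x * x) - star x * c * x)"
proof -
  let ?c = "Adjoin c 0" and ?x = "Adjoin x 0"
  have "norm_pos (norm ?c *\<^sub>R 1 - ?c)"
    using assms norm_pos_norm_minus cstar_pos_iff_norm_pos by blast
  then obtain d where d: "star d = d" "d * d = norm ?c *\<^sub>R 1 - ?c" using norm_pos_sqrt by blast
  have "star (d * ?x) * (d * ?x) = star ?x * (d * d) * ?x" by (simp add: star_simps d(1) mult.assoc)
  also have "\<dots> = Adjoin (norm c *\<^sub>R (star x * x) - star x * c * x) 0"
    unfolding d(2) by (simp add: algebra_simps) (simp add: embed_hom mult.assoc)
  finally show ?thesis unfolding cstar_pos_iff_norm_pos by (metis norm_pos_star_mult)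
qed

text \<open>
  The expression is \<open>(1 - u)\<^sup>* c (1 - u)\<close>, where \<open>u\<close> lies in the algebra. With \<open>d = 1 - c / t\<close>, a
  contraction, take for \<open>1 - u\<close> the mean \<open>m\<close> of the powers \<open>d\<^sup>k\<close>, \<open>k < n\<close>. The sum telescopes:
  \<open>c m = (t / n) (1 - d\<^sup>n)\<close>, which is small, while \<open>m\<close> stays a contraction.
\<close>

lemma approximate_right_unit:
  fixes c :: "'a::cstar_algebra"
  assumes c: "cstar_pos c" and e: "e > 0"
  obtains u where "norm (c - c * u - star u * c + star u * (c * u)) < e"
proof -
  define t where "t = norm c + 1"
  have t: "t > 0" by (simp add: t_def add_nonneg_pos)
  define d :: "'a unitization" where "d = 1 - (1/t) *\<^sub>R Adjoin c 0"
  have "norm (t *\<^sub>R 1 - Adjoin c 0) \<le> t"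
    using c by (intro norm_pos_bound) (simp_all add: cstar_pos_iff_norm_pos t_def)
  moreover have "d = (1/t) *\<^sub>R (t *\<^sub>R 1 - Adjoin c 0)" using t by (simp add: d_def algebra_simps)
  ultimately have nd: "norm d \<le> 1" using t by (simp only: norm_scaleR) (simp add: field_simps)
  have ndn: "norm (d ^ k) \<le> 1" for k by (meson norm_power_ineq nd norm_ge_zero order_trans power_le_one)
  have cd: "Adjoin c 0 = t *\<^sub>R (1 - d)" using t by (simp add: d_def)
  obtain n :: nat where n: "2 * t / e < real n" using reals_Archimedean2 by blast
  have n0: "n > 0" using n t e by (metis divide_pos_pos gr0I less_numeral_extra(3) mult_pos_pos of_nat_0 order_less_trans zero_less_numeral)
  define m where "m = (1 / real n) *\<^sub>R (\<Sum>k<n. d ^ k)"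
  have "norm m \<le> (1 / real n) * (\<Sum>k<n. norm (d ^ k))"
    unfolding m_def by (simp add: divide_right_mono norm_sum)
  also have "\<dots> \<le> (1 / real n) * (\<Sum>k<n. 1)" using ndn by (intro mult_left_mono sum_mono) auto
  finally have nm: "norm m \<le> 1" using n0 by simp
  have "Adjoin c 0 * m = (t / real n) *\<^sub>R ((1 - d) * (\<Sum>k<n. d ^ k))"
    by (simp add: cd m_def)
  also have "(1 - d) * (\<Sum>k<n. d ^ k) = 1 - d ^ n"
    by (induction n) (simp_all add: distrib_left, simp add: algebra_simps)
  finally have cm: "Adjoin c 0 * m = (t / real n) *\<^sub>R (1 - d ^ n)" .
  have "norm (1 - d ^ n) \<le> 2" using norm_triangle_ineq4[of 1 "d ^ n"] ndn[of n] by simp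
  then have "norm (Adjoin c 0 * m) \<le> (t / real n) * 2"
    unfolding cm using t n0 by (simp only: norm_scaleR) (simp add: divide_right_mono)
  also have "\<dots> < e" using n n0 e t by (simp add: field_simps)
  finally have ncm: "norm (Adjoin c 0 * m) < e" .
  have sd: "scalar_part (d ^ k) = 1" for k
    by (induction k) (simp_all add: one_unitization_def times_unitization_def d_def
        minus_unitization_def scaleR_unitization_def scaleC_unitization_def)
  have ssum: "scalar_part (\<Sum>k<j. d ^ k) = of_nat j" for j
    by (induction j) (simp_all add: sd plus_unitization_def zero_unitization_def)
  have "scalar_part m = 1" using n0 ssum[of n]
    by (simp add: m_def scaleR_unitization_def scaleC_unitization_def)
  \<comment> \<open>Every power of \<open>d\<close> has scalar part \<open>1\<close>, so \<open>1 - m\<close> belongs to the algebra.\<close>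
  define u where "u = - alg_part m"
  have m: "m = 1 - Adjoin u 0"
    using \<open>scalar_part m = 1\<close> by (simp add: unitization_eq_iff minus_unitization_def one_unitization_def u_def)
  have "Adjoin (c - c * u - star u * c + star u * (c * u)) 0 = star m * (Adjoin c 0 * m)"
    unfolding m by (simp add: star_simps algebra_simps) (simp add: embed_hom algebra_simps)
  then have "norm (c - c * u - star u * c + star u * (c * u)) = norm (star m * (Adjoin c 0 * m))"
    by (metis norm_embed)
  also have "\<dots> \<le> norm (star m) * norm (Adjoin c 0 * m)" by (rule norm_mult_ineq)
  also have "\<dots> \<le> 1 * norm (Adjoin c 0 * m)" using nm by (intro mult_right_mono) auto
  finally show thesis using ncm by (intro that[of u]) simp
qed

section \<open>Semi-inner-product modules\<close>

lemma is_adjointD: "is_adjoint ip T T' \<Longrightarrow> ip (T x) y = ip x (T' y)"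
  by (simp add: is_adjoint_def)

definition module_Cauchy :: "('x::ab_group_add \<Rightarrow> 'x \<Rightarrow> 'a::cstar_algebra) \<Rightarrow> (nat \<Rightarrow> 'x) \<Rightarrow> bool" where
  "module_Cauchy ip f \<longleftrightarrow>
    (\<forall>e>0. \<exists>N. \<forall>m\<ge>N. \<forall>n\<ge>N. module_norm ip (f m - f n) < e)"

definition module_tendsto ::
    "('x::ab_group_add \<Rightarrow> 'x \<Rightarrow> 'a::cstar_algebra) \<Rightarrow> (nat \<Rightarrow> 'x) \<Rightarrow> 'x \<Rightarrow> bool" where
  "module_tendsto ip f l \<longleftrightarrow> (\<lambda>n. module_norm ip (f n - l)) \<longlonglongrightarrow> 0"

lemma module_norm_nonneg [simp]: "0 \<le> module_norm ip x"
  by (simp add: module_norm_def)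

lemma module_norm_square: "(module_norm ip x)\<^sup>2 = norm (ip x x)"
  by (simp add: module_norm_def)

text \<open>
  The axioms on which the Cauchy-Schwarz inequality rests. The inequality is applied both to the finite
  sums of kernel functions and to their completion, at a stage where neither is known to be a Hilbert
  module.
\<close>

locale semi_inner_module =
  fixes X :: "'x::complex_vector set"
    and act :: "'x \<Rightarrow> 'a::cstar_algebra \<Rightarrow> 'x"
    and ip :: "'x \<Rightarrow> 'x \<Rightarrow> 'a"
  assumes zero_mem: "0 \<in> X"
    and add_mem: "x \<in> X \<Longrightarrow> y \<in> X \<Longrightarrow> x + y \<in> X"
    and scaleC_mem: "x \<in> X \<Longrightarrow> c *\<^sub>C x \<in> X"
    and act_mem: "x \<in> X \<Longrightarrow> act x a \<in> X"
    and ip_add_right: "x \<in> X \<Longrightarrow> y \<in> X \<Longrightarrow> z \<in> X \<Longrightarrow> ip x (y + z) = ip x y + ip x z"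
    and ip_scaleC_right: "x \<in> X \<Longrightarrow> y \<in> X \<Longrightarrow> ip x (c *\<^sub>C y) = c *\<^sub>C ip x y"
    and ip_act_right: "x \<in> X \<Longrightarrow> y \<in> X \<Longrightarrow> ip x (act y a) = ip x y * a"
    and ip_star: "x \<in> X \<Longrightarrow> y \<in> X \<Longrightarrow> ip y x = star (ip x y)"
    and ip_pos: "x \<in> X \<Longrightarrow> cstar_pos (ip x x)"
begin

lemma minus_mem: "x \<in> X \<Longrightarrow> - x \<in> X"
  using scaleC_mem[of x "-1"] by (simp add: minus_one_scaleC)

lemma diff_mem: "x \<in> X \<Longrightarrow> y \<in> X \<Longrightarrow> x - y \<in> X"
  using add_mem[of x "- y"] minus_mem by simp

lemma ip_minus_right: "x \<in> X \<Longrightarrow> y \<in> X \<Longrightarrow> ip x (- y) = - ip x y"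
  using ip_scaleC_right[of x y "-1"] by (simp add: minus_one_scaleC)

lemma ip_diff_right: "x \<in> X \<Longrightarrow> y \<in> X \<Longrightarrow> z \<in> X \<Longrightarrow> ip x (y - z) = ip x y - ip x z"
  using ip_add_right[of x y "- z"] by (simp add: minus_mem ip_minus_right)

lemma ip_zero_right [simp]: "x \<in> X \<Longrightarrow> ip x 0 = 0"
  using ip_add_right[of x 0 0] by (simp add: zero_mem)

lemma ip_add_left: "x \<in> X \<Longrightarrow> y \<in> X \<Longrightarrow> z \<in> X \<Longrightarrow> ip (x + y) z = ip x z + ip y z"
  using ip_star[of z "x + y"] ip_star[of z x] ip_star[of z y]
  by (simp add: add_mem ip_add_right star_add)

lemma ip_diff_left: "x \<in> X \<Longrightarrow> y \<in> X \<Longrightarrow> z \<in> X \<Longrightarrow> ip (x - y) z = ip x z - ip y z"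
  using ip_star[of z "x - y"] ip_star[of z x] ip_star[of z y]
  by (simp add: diff_mem ip_diff_right star_diff)

lemma ip_scaleC_left: "x \<in> X \<Longrightarrow> y \<in> X \<Longrightarrow> ip (c *\<^sub>C x) y = cnj c *\<^sub>C ip x y"
  using ip_star[of y "c *\<^sub>C x"] ip_star[of y x] by (simp add: scaleC_mem ip_scaleC_right star_scaleC)

lemma ip_act_left: "x \<in> X \<Longrightarrow> y \<in> X \<Longrightarrow> ip (act x a) y = star a * ip x y"
  using ip_star[of y "act x a"] ip_star[of y x] by (simp add: act_mem ip_act_right star_mult)

lemma ip_zero_left [simp]: "x \<in> X \<Longrightarrow> ip 0 x = 0"
  using ip_star[of x 0] by (simp add: zero_mem)

text \<open>
  Positivity of \<open>\<langle>z, z\<rangle>\<close> for \<open>z = x \<cdot> (\<langle>x, y\<rangle> / N) - y\<close>, together with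
  \<open>b\<^sup>* \<langle>x, x\<rangle> b \<le> N b\<^sup>* b\<close>, gives \<open>\<langle>x, y\<rangle>\<^sup>* \<langle>x, y\<rangle> \<le> N \<langle>y, y\<rangle>\<close>. The strict inequality for \<open>N\<close>
  covers the case \<open>\<langle>x, x\<rangle> = 0\<close>.
\<close>

lemma Cauchy_Schwarz_aux:
  assumes x: "x \<in> X" and y: "y \<in> X" and N: "norm (ip x x) < N"
  shows "(norm (ip x y))\<^sup>2 \<le> N * norm (ip y y)"
proof -
  let ?a = "ip x y" and ?c = "norm (ip x x)"
  have N0: "N > 0" using N norm_ge_zero order_le_less_trans by blast
  define b where "b = (1/N) *\<^sub>R ?a"
  define z where "z = act x b - y"
  have z: "z \<in> X" using x y by (simp add: z_def diff_mem act_mem)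
  have yx: "ip y x = star ?a" using x y by (simp add: ip_star[of x y])
  have two: "(2/N) *\<^sub>R v = (1/N) *\<^sub>R v + (1/N) *\<^sub>R v" for v :: 'a
    by (simp add: scaleR_left_distrib[symmetric])
  have "ip z z = star b * ip x x * b - star b * ?a - star ?a * b + ip y y"
    unfolding z_def using x y
    by (simp add: diff_mem act_mem ip_diff_left ip_diff_right ip_act_left ip_act_right yx algebra_simps)
  also have "\<dots> = star b * ip x x * b - (2/N) *\<^sub>R (star ?a * ?a) + ip y y"
    unfolding two by (simp add: b_def star_simps)
  finally have 1: "cstar_pos (star b * ip x x * b - (2/N) *\<^sub>R (star ?a * ?a) + ip y y)"
    using ip_pos[OF z] by simp
  have 2: "cstar_pos (?c *\<^sub>R (star b * b) - star b * ip x x * b)"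
    by (rule cstar_pos_conj_le[OF ip_pos[OF x]])
  have 3: "cstar_pos ((N - ?c) *\<^sub>R (star b * b))"
    using N by (intro cstar_pos_scaleR) (auto simp: cstar_pos_def)
  have bb: "N *\<^sub>R (star b * b) = (1/N) *\<^sub>R (star ?a * ?a)"
    using N0 by (simp add: b_def star_simps)
  have "cstar_pos (star b * ip x x * b - (2/N) *\<^sub>R (star ?a * ?a) + ip y y
      + (?c *\<^sub>R (star b * b) - star b * ip x x * b) + (N - ?c) *\<^sub>R (star b * b))"
    by (intro cstar_pos_add 1 2 3)
  also have "star b * ip x x * b - (2/N) *\<^sub>R (star ?a * ?a) + ip y y
      + (?c *\<^sub>R (star b * b) - star b * ip x x * b) + (N - ?c) *\<^sub>R (star b * b)
      = N *\<^sub>R (star b * b) - (2/N) *\<^sub>R (star ?a * ?a) + ip y y"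
    by (simp add: algebra_simps)
  also have "\<dots> = ip y y - (1/N) *\<^sub>R (star ?a * ?a)"
    unfolding bb two by simp
  finally have "norm ((1/N) *\<^sub>R (star ?a * ?a)) \<le> norm (ip y y)"
    using N0 by (intro cstar_pos_norm_mono cstar_pos_scaleR) (auto simp: cstar_pos_def)
  then show ?thesis using N0 by (simp add: norm_star_mult field_simps)
qed

theorem Cauchy_Schwarz:
  assumes "x \<in> X" "y \<in> X"
  shows "norm (ip x y) \<le> module_norm ip x * module_norm ip y"
proof (rule power2_le_imp_le)
  have "(norm (ip x y))\<^sup>2 \<le> norm (ip x x) * norm (ip y y)"
  proof (rule tendsto_lowerbound)
    show "((\<lambda>N. N * norm (ip y y)) \<longlongrightarrow> norm (ip x x) * norm (ip y y)) (at_right (norm (ip x x)))"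
      by (intro tendsto_intros)
    show "\<forall>\<^sub>F N in at_right (norm (ip x x)). (norm (ip x y))\<^sup>2 \<le> N * norm (ip y y)"
      using Cauchy_Schwarz_aux[OF assms] by (auto simp: eventually_at_filter)
  qed simp
  then show "(norm (ip x y))\<^sup>2 \<le> (module_norm ip x * module_norm ip y)\<^sup>2"
    by (simp add: power_mult_distrib module_norm_square)
qed simp

lemma module_norm_triangle:
  assumes "x \<in> X" "y \<in> X"
  shows "module_norm ip (x + y) \<le> module_norm ip x + module_norm ip y"
proof (rule power2_le_imp_le)
  let ?n = "module_norm ip"
  have "(?n (x + y))\<^sup>2 = norm ((ip x x + ip x y) + (ip y x + ip y y))"
    using assms by (simp add: module_norm_square add_mem ip_add_left ip_add_right algebra_simps)
  also have "\<dots> \<le> (norm (ip x x) + norm (ip x y)) + (norm (ip y x) + norm (ip y y))"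
    by (intro norm_triangle_mono order_refl)
  also have "\<dots> \<le> ((?n x)\<^sup>2 + ?n x * ?n y) + (?n y * ?n x + (?n y)\<^sup>2)"
    using assms by (intro add_mono Cauchy_Schwarz) (simp_all add: module_norm_square)
  finally show "(?n (x + y))\<^sup>2 \<le> (?n x + ?n y)\<^sup>2" by (simp add: power2_eq_square algebra_simps)
qed simp

lemma module_norm_scaleC: "x \<in> X \<Longrightarrow> module_norm ip (c *\<^sub>C x) = cmod c * module_norm ip x"
  by (simp add: module_norm_def ip_scaleC_left ip_scaleC_right scaleC_mem scaleC_scaleC norm_scaleC
      norm_mult real_sqrt_mult)

lemma module_norm_minus: "x \<in> X \<Longrightarrow> module_norm ip (- x) = module_norm ip x"
  using module_norm_scaleC[of x "-1"] by (simp add: minus_one_scaleC)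

lemma module_norm_minus_commute:
  "x \<in> X \<Longrightarrow> y \<in> X \<Longrightarrow> module_norm ip (x - y) = module_norm ip (y - x)"
  using module_norm_minus[of "x - y"] by (simp add: diff_mem)

lemma module_norm_diff_triangle:
  assumes "x \<in> X" "y \<in> X" "z \<in> X"
  shows "module_norm ip (x - z) \<le> module_norm ip (x - y) + module_norm ip (y - z)"
  using module_norm_triangle[of "x - y" "y - z"] assms by (simp add: diff_mem)

lemma module_norm_diff_le:
  assumes "x \<in> X" "y \<in> X"
  shows "module_norm ip x \<le> module_norm ip (x - y) + module_norm ip y"
  using module_norm_triangle[of "x - y" "y"] assms by (simp add: diff_mem)

lemma module_norm_act_le:
  assumes "x \<in> X"
  shows "module_norm ip (act x a) \<le> module_norm ip x * norm a"
proof (rule power2_le_imp_le)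
  have "(module_norm ip (act x a))\<^sup>2 = norm (star a * (ip x x * a))"
    using assms by (simp add: module_norm_square act_mem ip_act_left ip_act_right mult.assoc)
  also have "\<dots> \<le> norm (star a) * (norm (ip x x) * norm a)"
    by (meson norm_mult_ineq mult_left_mono norm_ge_zero order_trans)
  finally show "(module_norm ip (act x a))\<^sup>2 \<le> (module_norm ip x * norm a)\<^sup>2"
    by (simp add: power_mult_distrib module_norm_square power2_eq_square[of "norm a"] algebra_simps)
qed simp

lemma module_norm_zero [simp]: "module_norm ip 0 = 0"
  using zero_mem by (simp add: module_norm_def)

lemma norm_ip_diff_le:
  assumes "x \<in> X" "y \<in> X" "x' \<in> X" "y' \<in> X"
  shows "norm (ip x y - ip x' y')
    \<le> module_norm ip (x - x') * module_norm ip y + module_norm ip x' * module_norm ip (y - y')"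
proof -
  have "ip x y - ip x' y' = ip (x - x') y + ip x' (y - y')"
    using assms by (simp add: ip_diff_left ip_diff_right)
  also have "norm \<dots> \<le> norm (ip (x - x') y) + norm (ip x' (y - y'))" by (rule norm_triangle_ineq)
  also have "\<dots> \<le> module_norm ip (x - x') * module_norm ip y
      + module_norm ip x' * module_norm ip (y - y')"
    using assms by (intro add_mono Cauchy_Schwarz diff_mem)
  finally show ?thesis .
qed

lemma approximate_by_act:
  assumes x: "x \<in> X" and e: "e > 0"
  obtains u where "module_norm ip (x - act x u) < e"
proof -
  have "e\<^sup>2 > 0" using e by simp
  from approximate_right_unit[OF ip_pos[OF x] this] obtain u where
    u: "norm (ip x x - ip x x * u - star u * ip x x + star u * (ip x x * u)) < e\<^sup>2" by blast
  have "ip (x - act x u) (x - act x u)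
      = ip x x - ip x x * u - star u * ip x x + star u * (ip x x * u)"
    using x by (simp add: diff_mem act_mem ip_diff_left ip_diff_right ip_act_left ip_act_right
        algebra_simps)
  then have "(module_norm ip (x - act x u))\<^sup>2 < e\<^sup>2" using u by (simp add: module_norm_square)
  then show thesis using e that by (meson less_imp_le power2_less_imp_less)
qed

lemma module_Cauchy_bounded:
  assumes f: "\<And>n. f n \<in> X" and C: "module_Cauchy ip f"
  obtains B where "\<And>n. module_norm ip (f n) \<le> B"
proof -
  obtain N where N: "\<And>m n. m \<ge> N \<Longrightarrow> n \<ge> N \<Longrightarrow> module_norm ip (f m - f n) < 1"
    using C unfolding module_Cauchy_def by (meson zero_less_one)
  have "module_norm ip (f n) \<le> (\<Sum>k\<le>N. module_norm ip (f k)) + 1" for n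
  proof (cases "n \<le> N")
    case True
    then have "module_norm ip (f n) \<le> (\<Sum>k\<le>N. module_norm ip (f k))"
      by (intro member_le_sum) auto
    then show ?thesis by simp
  next
    case False
    then have "module_norm ip (f n) \<le> 1 + module_norm ip (f N)"
      using module_norm_diff_le[OF f f, of n N] N[of n N] by simp
    also have "module_norm ip (f N) \<le> (\<Sum>k\<le>N. module_norm ip (f k))"
      by (intro member_le_sum) auto
    finally show ?thesis by simp
  qed
  then show thesis by (rule that)
qed

lemma module_Cauchy_ip_convergent:
  assumes f: "\<And>n. f n \<in> X" "module_Cauchy ip f" and g: "\<And>n. g n \<in> X" "module_Cauchy ip g"
  shows "convergent (\<lambda>n. ip (f n) (g n))"
proof -
  obtain A B where A: "\<And>n. module_norm ip (f n) \<le> A" and B: "\<And>n. module_norm ip (g n) \<le> B"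
    using module_Cauchy_bounded[OF f] module_Cauchy_bounded[OF g] by metis
  define D where "D = max A B + 1"
  have D: "D > 0" "A \<le> D" "B \<le> D" using A[of 0] order_trans[OF module_norm_nonneg A[of 0]]
    by (simp_all add: D_def)
  have "Cauchy (\<lambda>n. ip (f n) (g n))" unfolding Cauchy_iff
  proof (intro allI impI)
    fix e :: real assume "e > 0"
    then have e: "e / (2 * D) > 0" using D by simp
    obtain M where M: "\<And>m n. m \<ge> M \<Longrightarrow> n \<ge> M \<Longrightarrow> module_norm ip (f m - f n) < e / (2 * D)"
      using f(2) e unfolding module_Cauchy_def by meson
    obtain N where N: "\<And>m n. m \<ge> N \<Longrightarrow> n \<ge> N \<Longrightarrow> module_norm ip (g m - g n) < e / (2 * D)"
      using g(2) e unfolding module_Cauchy_def by meson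
    have "norm (ip (f m) (g m) - ip (f n) (g n)) < e" if "m \<ge> max M N" "n \<ge> max M N" for m n
    proof -
      have "norm (ip (f m) (g m) - ip (f n) (g n))
          \<le> module_norm ip (f m - f n) * module_norm ip (g m)
            + module_norm ip (f n) * module_norm ip (g m - g n)"
        by (intro norm_ip_diff_le f g)
      also have "\<dots> \<le> module_norm ip (f m - f n) * D + D * module_norm ip (g m - g n)"
        using A[of n] B[of m] D by (intro add_mono mult_mono) auto
      also have "\<dots> < e / (2 * D) * D + D * (e / (2 * D))"
        using M[of m n] N[of m n] that D
          by (intro add_strict_mono mult_strict_right_mono mult_strict_left_mono) auto
      finally show ?thesis using D by simp
    qed
    then show "\<exists>M. \<forall>m\<ge>M. \<forall>n\<ge>M. norm (ip (f m) (g m) - ip (f n) (g n)) < e" by blast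
  qed
  then show ?thesis by (simp add: Cauchy_convergent_iff)
qed

lemma module_tendsto_ip:
  assumes f: "\<And>n. f n \<in> X" "x \<in> X" "module_tendsto ip f x" and y: "y \<in> X"
  shows "(\<lambda>n. ip (f n) y) \<longlonglongrightarrow> ip x y"
proof -
  have "norm (ip (f n) y - ip x y) \<le> norm (module_norm ip (f n - x)) * module_norm ip y" for n
    using Cauchy_Schwarz[of "f n - x" y] f y by (simp add: ip_diff_left diff_mem)
  then have "(\<lambda>n. ip (f n) y - ip x y) \<longlonglongrightarrow> 0"
    by (intro tendsto_0_le[OF f(3)[unfolded module_tendsto_def]] always_eventually allI)
  then show ?thesis by (simp add: LIM_zero_iff)
qed

end

lemma semi_inner_module_of_hilbert:
  assumes "hilbert_cstar_module X act ip"
  shows "semi_inner_module X act ip"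
proof -
  interpret hilbert_cstar_module X act ip by (rule assms)
  show ?thesis
    by (rule semi_inner_module.intro)
      (assumption | rule zero_mem add_mem scaleC_mem act_mem ip_add_right ip_scaleC_right
        ip_act_right ip_star ip_pos)+
qed

locale full_hilbert_module = E: hilbert_cstar_module UNIV act ip
  for act :: "'e::complex_vector \<Rightarrow> 'a::cstar_algebra \<Rightarrow> 'e" and ip
begin

sublocale E: semi_inner_module UNIV act ip
  by (rule semi_inner_module_of_hilbert) (rule E.hilbert_cstar_module_axioms)

lemma eq_if_ip_eq:
  assumes "\<And>z. ip x z = ip y z"
  shows "x = y"
proof -
  have "ip (x - y) (x - y) = 0" using assms by (simp add: E.ip_diff_left)
  then show ?thesis using E.ip_definite[of "x - y"] by simp
qed

lemma eq_if_ip_eq_right: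
  assumes "\<And>z. ip z x = ip z y"
  shows "x = y"
proof (rule eq_if_ip_eq)
  fix z
  have "ip x z = star (ip z x)" "ip y z = star (ip z y)" by (rule E.ip_star; simp)+
  then show "ip x z = ip y z" using assms by simp
qed

lemma is_adjoint_sym: "is_adjoint ip T T' \<Longrightarrow> is_adjoint ip T' T"
proof -
  assume T: "is_adjoint ip T T'"
  have "ip (T' x) y = ip x (T y)" for x y
  proof -
    have "ip (T' x) y = star (ip y (T' x))" by (rule E.ip_star; simp)
    also have "\<dots> = star (ip (T y) x)" by (simp add: is_adjointD[OF T])
    also have "\<dots> = ip x (T y)" by (rule E.ip_star[symmetric]; simp)
    finally show ?thesis .
  qed
  then show ?thesis by (simp add: is_adjoint_def)
qed

lemma is_adjoint_unique: "is_adjoint ip T T' \<Longrightarrow> is_adjoint ip T T'' \<Longrightarrow> T' = T''"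
  by (rule ext, rule eq_if_ip_eq_right) (metis is_adjointD)

lemma op_adj_eq: "is_adjoint ip T T' \<Longrightarrow> op_adj ip T = T'"
  unfolding op_adj_def by (rule the_equality) (auto dest: is_adjoint_unique)

lemma is_adjoint_op_adj: "adjointable ip T \<Longrightarrow> is_adjoint ip T (op_adj ip T)"
  unfolding adjointable_def using op_adj_eq by blast

lemma is_adjoint_add:
  "is_adjoint ip T T' \<Longrightarrow> is_adjoint ip R R' \<Longrightarrow> is_adjoint ip (T + R) (T' + R')"
  by (simp add: is_adjoint_def E.ip_add_left E.ip_add_right)

lemma is_adjoint_diff:
  "is_adjoint ip T T' \<Longrightarrow> is_adjoint ip R R' \<Longrightarrow> is_adjoint ip (T - R) (T' - R')"
  by (simp add: is_adjoint_def E.ip_diff_left E.ip_diff_right)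

lemma is_adjoint_scaleC: "is_adjoint ip T T' \<Longrightarrow> is_adjoint ip (c *\<^sub>C T) (cnj c *\<^sub>C T')"
  by (simp add: is_adjoint_def scaleC_fun_def E.ip_scaleC_left E.ip_scaleC_right)

lemma
  assumes "adjointable ip T"
  shows adjointable_scaleC: "T (c *\<^sub>C x) = c *\<^sub>C T x"
    and adjointable_act: "T (act x a) = act (T x) a"
proof -
  obtain T' where T': "is_adjoint ip T T'" using assms by (auto simp: adjointable_def)
  note adj = is_adjointD[OF T']
  show "T (c *\<^sub>C x) = c *\<^sub>C T x" by (rule eq_if_ip_eq) (simp add: adj E.ip_scaleC_left)
  show "T (act x a) = act (T x) a" by (rule eq_if_ip_eq) (simp add: adj E.ip_act_left)
qed

lemma module_norm_eq_0: "module_norm ip x = 0 \<longleftrightarrow> x = 0"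
  using E.ip_definite[of x] by (auto simp: module_norm_def)

text \<open>
  A uniform boundedness argument in the style of Sokal. If \<open>T\<close> is unbounded, choose unit vectors \<open>y\<^sub>n\<close>
  with \<open>norm (T y\<^sub>n) > 6\<^sup>n\<close>, and build \<open>x\<^sub>n\<close> by steps \<open>\<plusminus> w\<^sub>n\<close> of length \<open>3\<^sup>-\<^sup>n\<close> in the direction of \<open>T y\<^sub>n\<close>.
  One of the two signs makes \<open>norm \<langle>x\<^sub>n\<^sub>+\<^sub>1, T y\<^sub>n\<rangle> \<ge> 3\<^sup>-\<^sup>n norm (T y\<^sub>n)\<close>, and the remaining steps have total length
  at most \<open>3\<^sup>-\<^sup>n / 2\<close>, so that at least half of this survives for the limit \<open>l\<close>. This contradicts
  \<open>norm \<langle>l, T y\<^sub>n\<rangle> = norm \<langle>T\<^sup>* l, y\<^sub>n\<rangle> \<le> norm (T\<^sup>* l)\<close>.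
\<close>

theorem adjointable_bounded:
  assumes "adjointable ip T"
  shows "\<exists>C\<ge>0. \<forall>x. module_norm ip (T x) \<le> C * module_norm ip x"
proof (rule ccontr)
  assume no: "\<not> ?thesis"
  obtain T' where T': "is_adjoint ip T T'" using assms by (auto simp: adjointable_def)
  have T0: "T 0 = 0" using adjointable_scaleC[OF assms, of 0 0] by simp
  have "\<exists>y. module_norm ip y = 1 \<and> module_norm ip (T y) > (6::real) ^ n" for n :: nat
  proof -
    obtain y where y: "module_norm ip (T y) > 6 ^ n * module_norm ip y"
      using no by (meson linorder_not_le zero_le_numeral zero_le_power)
    then have "y \<noteq> 0" using T0 by auto
    then have n: "module_norm ip y > 0" using module_norm_eq_0[of y] module_norm_nonneg[of ip y] by linarith
    let ?c = "complex_of_real (1 / module_norm ip y)"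
    have "module_norm ip (?c *\<^sub>C y) = 1" using n by (simp add: E.module_norm_scaleC norm_divide)
    moreover have "module_norm ip (T (?c *\<^sub>C y)) > 6 ^ n"
      using n y by (simp add: adjointable_scaleC[OF assms] E.module_norm_scaleC norm_divide field_simps)
    ultimately show ?thesis by blast
  qed
  then obtain y where y: "\<And>n. module_norm ip (y n) = 1" "\<And>n. module_norm ip (T (y n)) > (6::real) ^ n"
    by metis
  define w where "w n = complex_of_real ((1/3) ^ n / module_norm ip (T (y n))) *\<^sub>C T (y n)" for n
  have nT: "module_norm ip (T (y n)) > 0" for n
    using y(2)[of n] by (rule less_trans[rotated]) simp
  have w: "module_norm ip (w n) = (1/3) ^ n" for n
    using nT[of n] by (simp add: w_def E.module_norm_scaleC norm_divide norm_power)
  have wT: "norm (ip (w n) (T (y n))) = (1/3) ^ n * module_norm ip (T (y n))" for n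
    using nT[of n] by (simp add: w_def E.ip_scaleC_left norm_scaleC norm_divide norm_power
        module_norm_square[symmetric] power2_eq_square)
  define x where "x = rec_nat 0 (\<lambda>n v. if norm (ip (v + w n) (T (y n))) \<ge> (1/3) ^ n * module_norm ip (T (y n))
      then v + w n else v - w n)"
  have xS: "x (Suc n) = (if norm (ip (x n + w n) (T (y n))) \<ge> (1/3) ^ n * module_norm ip (T (y n))
      then x n + w n else x n - w n)" for n by (simp add: x_def)
  have big: "norm (ip (x (Suc n)) (T (y n))) \<ge> (1/3) ^ n * module_norm ip (T (y n))" for n
  proof -
    let ?p = "ip (x n) (T (y n))" and ?q = "ip (w n) (T (y n))"
    have "2 * norm ?q = norm ((?p + ?q) - (?p - ?q))" by (simp add: scaleR_2[symmetric])
    also have "\<dots> \<le> norm (?p + ?q) + norm (?p - ?q)" by (rule norm_triangle_ineq4)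
    finally show ?thesis unfolding xS by (simp add: wT E.ip_add_left E.ip_diff_left)
  qed
  have step: "module_norm ip (x (Suc n) - x n) = (1/3) ^ n" for n
    by (simp add: xS w E.module_norm_minus)
  have dist: "module_norm ip (x (n + k) - x n) \<le> (3/2) * ((1/3) ^ n - (1/3) ^ (n + k))" for n k
  proof (induction k)
    case (Suc k)
    have "module_norm ip (x (n + Suc k) - x n)
        \<le> module_norm ip (x (Suc (n + k)) - x (n + k)) + module_norm ip (x (n + k) - x n)"
      using E.module_norm_diff_triangle[of "x (n + Suc k)" "x (n + k)" "x n"] by simp
    with Suc show ?case by (simp add: step)
  qed simp
  then have dist: "module_norm ip (x (n + k) - x n) \<le> (3/2) * (1/3) ^ n" for n k
    by (rule order_trans) (simp add: zero_le_power)
  have "\<exists>l\<in>UNIV. (\<lambda>n. module_norm ip (x n - l)) \<longlonglongrightarrow> 0"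
  proof (rule E.complete)
    fix e :: real assume "e > 0"
    then obtain N where N: "(1/3) ^ N < e / 3" using real_arch_pow_inv[of "e/3" "1/3"] by auto
    have "module_norm ip (x m - x n) < e" if "m \<ge> N" "n \<ge> N" for m n
    proof -
      have "module_norm ip (x m - x n) \<le> module_norm ip (x m - x N) + module_norm ip (x n - x N)"
        using E.module_norm_diff_triangle[of "x m" "x N" "x n"] E.module_norm_minus_commute[of "x n"]
        by simp
      also have "\<dots> \<le> (3/2) * (1/3) ^ N + (3/2) * (1/3) ^ N"
        using dist[of N "m - N"] dist[of N "n - N"] that by simp
      also have "\<dots> < e" using N by simp
      finally show ?thesis .
    qed
    then show "\<exists>N. \<forall>m\<ge>N. \<forall>n\<ge>N. module_norm ip (x m - x n) < e" by blast
  qed simp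
  then obtain l where l: "(\<lambda>n. module_norm ip (x n - l)) \<longlonglongrightarrow> 0" by blast
  have close: "module_norm ip (x n - l) \<le> (3/2) * (1/3) ^ n" for n
  proof (rule LIMSEQ_le_const)
    show "(\<lambda>k. (3/2) * (1/3) ^ n + module_norm ip (x (n + k) - l)) \<longlonglongrightarrow> (3/2) * (1/3) ^ n"
      using tendsto_add[OF tendsto_const[of "(3/2) * (1/3) ^ n"] LIMSEQ_ignore_initial_segment[OF l, of n]]
      by (simp only: add.commute[of _ n]) simp
    have "module_norm ip (x n - l) \<le> (3/2) * (1/3) ^ n + module_norm ip (x (n + k) - l)" for k
      using E.module_norm_diff_triangle[of "x n" "x (n + k)" l] dist[of n k]
        E.module_norm_minus_commute[of "x n" "x (n + k)"] by simp
    then show "\<exists>N. \<forall>k\<ge>N. module_norm ip (x n - l) \<le> (3/2) * (1/3) ^ n + module_norm ip (x (n + k) - l)"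
      by blast
  qed
  have "2 ^ n \<le> 2 * module_norm ip (T' l)" for n
  proof -
    let ?t = "module_norm ip (T (y n))"
    have "norm (ip (x (Suc n)) (T (y n))) \<le> norm (ip (x (Suc n) - l) (T (y n))) + norm (ip l (T (y n)))"
      using norm_triangle_ineq[of "ip (x (Suc n) - l) (T (y n))" "ip l (T (y n))"]
      by (simp add: E.ip_diff_left)
    also have "norm (ip (x (Suc n) - l) (T (y n))) \<le> (3/2) * (1/3) ^ Suc n * ?t"
      using E.Cauchy_Schwarz[of "x (Suc n) - l" "T (y n)"] mult_right_mono[OF close[of "Suc n"], of ?t]
      by simp
    also have "ip l (T (y n)) = ip (T' l) (y n)"
      using is_adjointD[OF is_adjoint_sym[OF T']] by simp
    also have "norm (ip (T' l) (y n)) \<le> module_norm ip (T' l)"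
      using E.Cauchy_Schwarz[of "T' l" "y n"] y(1) by simp
    finally have "(1/3) ^ n * ?t \<le> (1/2) * ((1/3) ^ n * ?t) + module_norm ip (T' l)"
      using big[of n] by simp
    moreover have "(1/3) ^ n * 6 ^ n \<le> (1/3) ^ n * ?t" using y(2)[of n] by (intro mult_left_mono) auto
    moreover have "(1/3) ^ n * 6 ^ n = (2::real) ^ n" by (simp add: power_mult_distrib[symmetric])
    ultimately show ?thesis by simp
  qed
  moreover obtain n where "2 * module_norm ip (T' l) < 2 ^ n"
    using real_arch_pow[of 2] by auto
  ultimately show False by (meson not_le)
qed

end

section \<open>Completion of a module of functions\<close>

lemma module_norm_squeeze:
  assumes "b \<longlonglongrightarrow> (0::real)" "\<And>n. module_norm ip (f n) \<le> b n"
  shows "(\<lambda>n. module_norm ip (f n)) \<longlonglongrightarrow> 0"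
  by (rule tendsto_sandwich[OF always_eventually always_eventually tendsto_const assms(1)])
    (auto simp: assms(2))

text \<open>
  This lemma and the next one serve for all operations on sequences: each operation is Lipschitz in its
  arguments. The three inner products may live on different modules, as is the case for evaluation at a
  point.
\<close>

lemma module_Cauchy_combine:
  assumes "module_Cauchy ip f" "module_Cauchy ip' g" "A \<ge> 0" "B \<ge> 0"
    and le: "\<And>m n. module_norm ip'' (h m - h n)
      \<le> A * module_norm ip (f m - f n) + B * module_norm ip' (g m - g n)"
  shows "module_Cauchy ip'' h"
  unfolding module_Cauchy_def
proof (intro allI impI)
  fix e :: real assume "e > 0"
  define D where "D = A + B + 1"
  have D: "D > 0" using assms by (simp add: D_def)
  have e: "e / D > 0" using D \<open>e > 0\<close> by simp
  obtain M where M: "\<forall>m\<ge>M. \<forall>n\<ge>M. module_norm ip (f m - f n) < e / D"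
    using assms(1) e unfolding module_Cauchy_def by blast
  obtain N where N: "\<forall>m\<ge>N. \<forall>n\<ge>N. module_norm ip' (g m - g n) < e / D"
    using assms(2) e unfolding module_Cauchy_def by blast
  have "module_norm ip'' (h m - h n) < e" if "m \<ge> max M N" "n \<ge> max M N" for m n
  proof -
    have "module_norm ip'' (h m - h n) \<le> A * (e / D) + B * (e / D)"
      using le[of m n] M[rule_format, of m n] N[rule_format, of m n] that assms(3,4)
      by (smt (verit) max.bounded_iff mult_left_mono)
    also have "\<dots> < A * (e / D) + B * (e / D) + e / D" using e by linarith
    also have "\<dots> = D * (e / D)" unfolding D_def by (simp only: distrib_right mult_1_left)
    finally show ?thesis using D by simp
  qed
  then show "\<exists>N. \<forall>m\<ge>N. \<forall>n\<ge>N. module_norm ip'' (h m - h n) < e" by blast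
qed

lemma module_tendsto_combine:
  assumes "module_tendsto ip f x" "module_tendsto ip' g y"
    and le: "\<And>n. module_norm ip'' (h n - z)
      \<le> A * module_norm ip (f n - x) + B * module_norm ip' (g n - y)"
  shows "module_tendsto ip'' h z"
  unfolding module_tendsto_def
proof (rule module_norm_squeeze[OF _ le])
  show "(\<lambda>n. A * module_norm ip (f n - x) + B * module_norm ip' (g n - y)) \<longlonglongrightarrow> 0"
    using assms(1,2) unfolding module_tendsto_def by (auto intro!: tendsto_eq_intros)
qed

context semi_inner_module
begin

lemma module_norm_add_diff_le:
  assumes "x \<in> X" "y \<in> X" "x' \<in> X" "y' \<in> X"
  shows "module_norm ip (x + y - (x' + y')) \<le> 1 * module_norm ip (x - x') + 1 * module_norm ip (y - y')"
  using module_norm_triangle[of "x - x'" "y - y'"] assms by (simp add: diff_mem algebra_simps)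

lemma module_norm_diff_diff_le:
  assumes "x \<in> X" "y \<in> X" "x' \<in> X" "y' \<in> X"
  shows "module_norm ip (x - y - (x' - y')) \<le> 1 * module_norm ip (x - x') + 1 * module_norm ip (y - y')"
  using module_norm_add_diff_le[of x "- y" x' "- y'"] module_norm_minus_commute[of y y'] assms
  by (simp add: minus_mem)

lemma module_norm_scaleC_diff_le:
  assumes "x \<in> X" "x' \<in> X"
  shows "module_norm ip (c *\<^sub>C x - c *\<^sub>C x')
    \<le> cmod c * module_norm ip (x - x') + 0 * module_norm ip (x - x')"
  using module_norm_scaleC[of "x - x'" c] assms by (simp add: diff_mem scaleC_diff_right)

end

context full_hilbert_module
begin

lemma module_tendsto_unique:
  assumes "module_tendsto ip f x" "module_tendsto ip f y"
  shows "x = y"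
proof -
  have "(\<lambda>n. module_norm ip (f n - x) + module_norm ip (f n - y)) \<longlonglongrightarrow> 0"
    using assms unfolding module_tendsto_def by (auto intro!: tendsto_eq_intros)
  moreover have "module_norm ip (x - y) \<le> module_norm ip (f n - x) + module_norm ip (f n - y)" for n
    using E.module_norm_diff_triangle[of x "f n" y] E.module_norm_minus_commute[of x "f n"] by simp
  ultimately have "module_norm ip (x - y) \<le> 0" by (intro LIMSEQ_le_const) auto
  then show ?thesis using module_norm_eq_0[of "x - y"] module_norm_nonneg[of ip "x - y"] by simp
qed

lemma act_diff_left: "act (x - y) a = act x a - act y a"
  using E.act_add_left[of "x - y" y a] by simp

lemma module_norm_act_diff_le:
  "module_norm ip (act x a - act x' a)
    \<le> norm a * module_norm ip (x - x') + 0 * module_norm ip (x - x')"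
  using E.module_norm_act_le[of "x - x'" a] by (simp add: act_diff_left mult.commute)

end

text \<open>
  The conditions for the completion to consist of functions: \<open>eval_bounded\<close> yields a pointwise limit
  for every Cauchy sequence, and \<open>null\<close> says that the pointwise limit determines the class of the
  sequence.
\<close>

locale function_module = full_hilbert_module act ip + F: semi_inner_module X "fun_act act" ipX
  for act :: "'e::complex_vector \<Rightarrow> 'a::cstar_algebra \<Rightarrow> 'e" and ip
    and X :: "('s \<Rightarrow> 'e) set" and ipX +
  assumes eval_bounded: "\<exists>C\<ge>0. \<forall>f\<in>X. module_norm ip (f s) \<le> C * module_norm ipX f"
    and null: "(\<And>n. f n \<in> X) \<Longrightarrow> module_Cauchy ipX f \<Longrightarrow>
      (\<And>s. module_tendsto ip (\<lambda>n. f n s) 0) \<Longrightarrow> module_tendsto ipX f 0"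
begin

definition approx :: "(nat \<Rightarrow> 's \<Rightarrow> 'e) \<Rightarrow> ('s \<Rightarrow> 'e) \<Rightarrow> bool" where
  "approx f F \<longleftrightarrow> (\<forall>n. f n \<in> X) \<and> module_Cauchy ipX f \<and> (\<forall>s. module_tendsto ip (\<lambda>n. f n s) (F s))"

definition H :: "('s \<Rightarrow> 'e) set" where "H = {F. \<exists>f. approx f F}"

text \<open>
  The choice of approximating sequences does not matter, as the lemma \<open>approx_ip\<close> shows.
\<close>

definition ipH :: "('s \<Rightarrow> 'e) \<Rightarrow> ('s \<Rightarrow> 'e) \<Rightarrow> 'a" where
  "ipH F G = lim (\<lambda>n. ipX ((SOME f. approx f F) n) ((SOME g. approx g G) n))"

lemma approxD:
  assumes "approx f F"
  shows "f n \<in> X" "module_Cauchy ipX f" "module_tendsto ip (\<lambda>n. f n s) (F s)"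
  using assms by (auto simp: approx_def)

lemma approx_diff_null:
  assumes f: "approx f F" and g: "approx g F"
  shows "(\<lambda>n. module_norm ipX (f n - g n)) \<longlonglongrightarrow> 0"
proof -
  have "module_tendsto ipX (\<lambda>n. f n - g n) 0"
  proof (rule null)
    show "f n - g n \<in> X" for n using f g by (simp add: approxD F.diff_mem)
    show "module_Cauchy ipX (\<lambda>n. f n - g n)"
      by (rule module_Cauchy_combine[OF approxD(2)[OF f] approxD(2)[OF g] _ _ F.module_norm_diff_diff_le])
        (use f g in \<open>auto simp: approxD\<close>)
    show "module_tendsto ip (\<lambda>n. (f n - g n) s) 0" for s
      by (rule module_tendsto_combine[OF approxD(3)[OF f, of s] approxD(3)[OF g, of s], of _ _ _ 1 1])
        (use E.module_norm_diff_diff_le[of "f _ s" "g _ s" "F s" "F s"] in simp)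
  qed
  then show ?thesis by (simp add: module_tendsto_def)
qed

lemma approx_ip:
  assumes f: "approx f F" and g: "approx g G"
  shows "(\<lambda>n. ipX (f n) (g n)) \<longlonglongrightarrow> ipH F G"
proof -
  define f' where "f' = (SOME f. approx f F)"
  define g' where "g' = (SOME g. approx g G)"
  have f': "approx f' F" unfolding f'_def by (rule someI[where P = "\<lambda>f. approx f F", OF f])
  have g': "approx g' G" unfolding g'_def by (rule someI[where P = "\<lambda>g. approx g G", OF g])
  have lim: "(\<lambda>n. ipX (f' n) (g' n)) \<longlonglongrightarrow> ipH F G"
    unfolding ipH_def f'_def[symmetric] g'_def[symmetric] using f' g'
    by (intro convergent_LIMSEQ_iff[THEN iffD1] F.module_Cauchy_ip_convergent) (auto simp: approxD)
  obtain A where A: "\<And>n. module_norm ipX (f' n) \<le> A"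
    using F.module_Cauchy_bounded[OF approxD(1,2)[OF f']] by metis
  obtain B where B: "\<And>n. module_norm ipX (g n) \<le> B"
    using F.module_Cauchy_bounded[OF approxD(1,2)[OF g]] by metis
  have "(\<lambda>n. ipX (f n) (g n) - ipX (f' n) (g' n)) \<longlonglongrightarrow> 0"
  proof (rule tendsto_0_le)
    show "(\<lambda>n. module_norm ipX (f n - f' n) * B + A * module_norm ipX (g n - g' n)) \<longlonglongrightarrow> 0"
      using approx_diff_null[OF f f'] approx_diff_null[OF g g'] by (auto intro!: tendsto_eq_intros)
    show "\<forall>\<^sub>F n in sequentially. norm (ipX (f n) (g n) - ipX (f' n) (g' n))
        \<le> norm (module_norm ipX (f n - f' n) * B + A * module_norm ipX (g n - g' n)) * 1"
    proof (rule always_eventually, rule allI)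
      fix n
      have "norm (ipX (f n) (g n) - ipX (f' n) (g' n)) \<le> module_norm ipX (f n - f' n) * module_norm ipX (g n)
          + module_norm ipX (f' n) * module_norm ipX (g n - g' n)"
        using f f' g g' by (intro F.norm_ip_diff_le) (auto simp: approxD)
      also have "\<dots> \<le> module_norm ipX (f n - f' n) * B + A * module_norm ipX (g n - g' n)"
        using A[of n] B[of n] by (intro add_mono mult_left_mono mult_right_mono) auto
      also have "\<dots> \<le> norm (module_norm ipX (f n - f' n) * B + A * module_norm ipX (g n - g' n)) * 1"
        by simp
      finally show "norm (ipX (f n) (g n) - ipX (f' n) (g' n))
        \<le> norm (module_norm ipX (f n - f' n) * B + A * module_norm ipX (g n - g' n)) * 1" .
    qed
  qed
  from tendsto_add[OF this lim] show ?thesis by simp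
qed

lemma approx_ip_eq: "approx f F \<Longrightarrow> approx g G \<Longrightarrow> (\<lambda>n. ipX (f n) (g n)) \<longlonglongrightarrow> l \<Longrightarrow> ipH F G = l"
  using approx_ip LIMSEQ_unique by blast

lemma approx_const:
  assumes "f \<in> X"
  shows "approx (\<lambda>n. f) f"
  using assms unfolding approx_def module_Cauchy_def module_tendsto_def by simp

lemma subset_H: "X \<subseteq> H"
  using approx_const by (auto simp: H_def)

lemma ipH_eq_ipX: "f \<in> X \<Longrightarrow> g \<in> X \<Longrightarrow> ipH f g = ipX f g"
  by (rule approx_ip_eq[OF approx_const approx_const]) auto

lemma approx_add:
  assumes f: "approx f F" and g: "approx g G"
  shows "approx (\<lambda>n. f n + g n) (F + G)"
  unfolding approx_def
proof (intro conjI allI)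
  show "f n + g n \<in> X" for n using f g by (simp add: approxD F.add_mem)
  show "module_Cauchy ipX (\<lambda>n. f n + g n)"
    by (rule module_Cauchy_combine[OF approxD(2)[OF f] approxD(2)[OF g] _ _ F.module_norm_add_diff_le])
      (use f g in \<open>auto simp: approxD\<close>)
  show "module_tendsto ip (\<lambda>n. (f n + g n) s) ((F + G) s)" for s
    by (rule module_tendsto_combine[OF approxD(3)[OF f, of s] approxD(3)[OF g, of s], of _ _ _ 1 1])
      (use E.module_norm_add_diff_le[of "f _ s" "g _ s" "F s" "G s"] in simp)
qed

lemma approx_scaleC:
  assumes f: "approx f F"
  shows "approx (\<lambda>n. c *\<^sub>C f n) (c *\<^sub>C F)"
  unfolding approx_def
proof (intro conjI allI)
  show "c *\<^sub>C f n \<in> X" for n using f by (simp add: approxD F.scaleC_mem)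
  show "module_Cauchy ipX (\<lambda>n. c *\<^sub>C f n)"
    by (rule module_Cauchy_combine[OF approxD(2)[OF f] approxD(2)[OF f] _ _ F.module_norm_scaleC_diff_le])
      (use f in \<open>auto simp: approxD\<close>)
  show "module_tendsto ip (\<lambda>n. (c *\<^sub>C f n) s) ((c *\<^sub>C F) s)" for s
    by (rule module_tendsto_combine[OF approxD(3)[OF f, of s] approxD(3)[OF f, of s], of _ _ _ "cmod c" 0])
      (use E.module_norm_scaleC_diff_le[of "f _ s" "F s"] in \<open>simp add: scaleC_fun_def\<close>)
qed

lemma fun_act_diff: "fun_act act f a - fun_act act g a = fun_act act (f - g) a"
  by (rule ext) (simp add: fun_act_def act_diff_left)

lemma approx_act:
  assumes f: "approx f F"
  shows "approx (\<lambda>n. fun_act act (f n) a) (fun_act act F a)"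
  unfolding approx_def
proof (intro conjI allI)
  show "fun_act act (f n) a \<in> X" for n using f by (simp add: approxD F.act_mem)
  have "module_norm ipX (fun_act act (f m) a - fun_act act (f n) a)
      \<le> norm a * module_norm ipX (f m - f n) + 0 * module_norm ipX (f m - f n)" for m n
    using F.module_norm_act_le[of "f m - f n" a] f
    by (simp add: fun_act_diff approxD F.diff_mem mult.commute)
  then show "module_Cauchy ipX (\<lambda>n. fun_act act (f n) a)"
    by (rule module_Cauchy_combine[OF approxD(2)[OF f] approxD(2)[OF f], rotated 2]) auto
  show "module_tendsto ip (\<lambda>n. fun_act act (f n) a s) (fun_act act F a s)" for s
    by (rule module_tendsto_combine[OF approxD(3)[OF f, of s] approxD(3)[OF f, of s], of _ _ _ "norm a" 0])
      (use module_norm_act_diff_le[of "f _ s" a "F s"] in \<open>simp add: fun_act_def\<close>)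
qed

lemma H_E:
  assumes "F \<in> H"
  obtains f where "approx f F"
  using assms by (auto simp: H_def)

lemma H_I: "approx f F \<Longrightarrow> F \<in> H"
  by (auto simp: H_def)

sublocale H: semi_inner_module H "fun_act act" ipH
proof
  show "0 \<in> H" using subset_H F.zero_mem by blast
next
  fix F G assume "F \<in> H" "G \<in> H"
  then show "F + G \<in> H" by (meson H_E H_I approx_add)
next
  fix F c assume "F \<in> H"
  then show "c *\<^sub>C F \<in> H" by (meson H_E H_I approx_scaleC)
next
  fix F a assume "F \<in> H"
  then show "fun_act act F a \<in> H" by (meson H_E H_I approx_act)
next
  fix F G K assume "F \<in> H" "G \<in> H" "K \<in> H"
  then obtain f g k where a: "approx f F" "approx g G" "approx k K" by (metis H_E)
  show "ipH F (G + K) = ipH F G + ipH F K"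
  proof (rule approx_ip_eq[OF a(1) approx_add[OF a(2,3)]])
    have "(\<lambda>n. ipX (f n) (g n) + ipX (f n) (k n)) \<longlonglongrightarrow> ipH F G + ipH F K"
      by (intro tendsto_add approx_ip a)
    then show "(\<lambda>n. ipX (f n) (g n + k n)) \<longlonglongrightarrow> ipH F G + ipH F K"
      using a by (simp add: approxD F.ip_add_right)
  qed
next
  fix F G c assume "F \<in> H" "G \<in> H"
  then obtain f g where a: "approx f F" "approx g G" by (metis H_E)
  show "ipH F (c *\<^sub>C G) = c *\<^sub>C ipH F G"
  proof (rule approx_ip_eq[OF a(1) approx_scaleC[OF a(2)]])
    have "(\<lambda>n. norm (c *\<^sub>C (ipX (f n) (g n) - ipH F G))) \<longlonglongrightarrow> 0"
      using tendsto_mult[OF tendsto_const[of "cmod c"] tendsto_norm_zero[OF LIM_zero[OF approx_ip[OF a]]]]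
      by (simp add: norm_scaleC)
    then have "(\<lambda>n. c *\<^sub>C ipX (f n) (g n)) \<longlonglongrightarrow> c *\<^sub>C ipH F G"
      by (simp add: tendsto_norm_zero_iff scaleC_diff_right LIM_zero_iff)
    then show "(\<lambda>n. ipX (f n) (c *\<^sub>C g n)) \<longlonglongrightarrow> c *\<^sub>C ipH F G"
      using a by (simp add: approxD F.ip_scaleC_right)
  qed
next
  fix F G a assume "F \<in> H" "G \<in> H"
  then obtain f g where a: "approx f F" "approx g G" by (metis H_E)
  show "ipH F (fun_act act G a) = ipH F G * a"
  proof (rule approx_ip_eq[OF a(1) approx_act[OF a(2)]])
    have "(\<lambda>n. ipX (f n) (g n) * a) \<longlonglongrightarrow> ipH F G * a"
      by (intro tendsto_intros approx_ip a)
    then show "(\<lambda>n. ipX (f n) (fun_act act (g n) a)) \<longlonglongrightarrow> ipH F G * a"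
      using a by (simp add: approxD F.ip_act_right)
  qed
next
  fix F G assume "F \<in> H" "G \<in> H"
  then obtain f g where a: "approx f F" "approx g G" by (metis H_E)
  show "ipH G F = star (ipH F G)"
  proof (rule approx_ip_eq[OF a(2,1)])
    have "ipX (g n) (f n) = star (ipX (f n) (g n))" for n
      using a by (intro F.ip_star) (auto simp: approxD)
    then show "(\<lambda>n. ipX (g n) (f n)) \<longlonglongrightarrow> star (ipH F G)"
      using tendsto_star[OF approx_ip[OF a]] by simp
  qed
next
  fix F assume "F \<in> H"
  then obtain f where a: "approx f F" by (metis H_E)
  show "cstar_pos (ipH F F)"
    by (rule cstar_pos_closed[OF F.ip_pos approx_ip[OF a a]]) (use a in \<open>simp add: approxD\<close>)
qed

lemma module_norm_ipH_eq: "f \<in> X \<Longrightarrow> module_norm ipH f = module_norm ipX f"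
  by (simp add: module_norm_def ipH_eq_ipX)

lemma approx_module_tendsto:
  assumes a: "approx f F"
  shows "module_tendsto ipH f F"
  unfolding module_tendsto_def
proof (rule LIMSEQ_I)
  fix r :: real assume r: "r > 0"
  then obtain N where N: "\<forall>m\<ge>N. \<forall>n\<ge>N. module_norm ipX (f m - f n) < r / 2"
    using approxD(2)[OF a] half_gt_zero unfolding module_Cauchy_def by blast
  have "module_norm ipH (f n - F) \<le> r / 2" if n: "n \<ge> N" for n
  proof -
    have fX: "f n \<in> X" by (rule approxD(1)[OF a])
    have d: "approx (\<lambda>m. f n - f m) (f n - F)"
      using approx_add[OF approx_const[OF fX] approx_scaleC[OF a, of "-1"]]
      by (simp add: minus_one_scaleC)
    have "(\<lambda>m. module_norm ipX (f n - f m)) \<longlonglongrightarrow> module_norm ipH (f n - F)"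
      unfolding module_norm_def by (intro tendsto_intros approx_ip d)
    then show ?thesis
      by (rule LIMSEQ_le_const2) (use N n in \<open>auto intro!: exI[of _ N] less_imp_le\<close>)
  qed
  then have "norm (module_norm ipH (f n - F) - 0) < r" if "n \<ge> N" for n
    using r that by fastforce
  then show "\<exists>N. \<forall>n\<ge>N. norm (module_norm ipH (f n - F) - 0) < r" by blast
qed

lemma dense_in_H:
  assumes "F \<in> H" "e > 0"
  obtains f where "f \<in> X" "module_norm ipH (F - f) < e"
proof -
  obtain f where a: "approx f F" using assms(1) by (rule H_E)
  obtain n where "norm (module_norm ipH (f n - F) - 0) < e"
    using approx_module_tendsto[OF a] assms(2) unfolding module_tendsto_def LIMSEQ_iff by blast
  then show thesis
    using that[of "f n"] H.module_norm_minus_commute[of "f n" F] approxD(1)[OF a] subset_H assms(1)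
    by (simp add: subset_iff)
qed

lemma ipH_definite:
  assumes "F \<in> H" "ipH F F = 0"
  shows "F = 0"
proof
  fix s
  obtain f where a: "approx f F" using assms(1) by (rule H_E)
  obtain C where C: "\<forall>f\<in>X. module_norm ip (f s) \<le> C * module_norm ipX f"
    using eval_bounded by blast
  have "(\<lambda>n. module_norm ipX (f n)) \<longlonglongrightarrow> sqrt (norm (0::'a))"
    unfolding module_norm_def using approx_ip[OF a a] assms(2) by (intro tendsto_intros) simp
  then have f0: "module_tendsto ipX f 0" by (simp add: module_tendsto_def)
  have "module_tendsto ip (\<lambda>n. f n s) 0"
    by (rule module_tendsto_combine[OF f0 f0, of _ _ _ C 0]) (use C approxD(1)[OF a] in simp)
  then show "F s = 0 s" using module_tendsto_unique[OF _ approxD(3)[OF a]] by simp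
qed

text \<open>
  Replace the given sequence by a sequence from the original module that is within \<open>1 / (n + 1)\<close> of it.
  Its pointwise limit exists by completeness of the value module, and it approximates that limit by definition of
  \<open>H\<close>.
\<close>

lemma H_complete:
  assumes FH: "\<And>n. F n \<in> H" and C: "module_Cauchy ipH F"
  shows "\<exists>L\<in>H. module_tendsto ipH F L"
proof -
  have "\<exists>g. g \<in> X \<and> module_norm ipH (F n - g) < inverse (real (Suc n))" for n
    by (rule dense_in_H[OF FH[of n], of "inverse (real (Suc n))"]) auto
  then obtain g where gX: "\<And>n. g n \<in> X" and g: "\<And>n. module_norm ipH (F n - g n) < inverse (real (Suc n))"
    by metis
  have gH: "g n \<in> H" for n using gX subset_H by blast
  have g0: "(\<lambda>n. module_norm ipH (F n - g n)) \<longlonglongrightarrow> 0"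
    by (rule module_norm_squeeze[OF LIMSEQ_inverse_real_of_nat less_imp_le[OF g]])
  have gC: "module_Cauchy ipX g" unfolding module_Cauchy_def
  proof (intro allI impI)
    fix e :: real assume e: "e > 0"
    obtain M where M: "\<forall>m\<ge>M. \<forall>n\<ge>M. module_norm ipH (F m - F n) < e / 3"
      using C e unfolding module_Cauchy_def by (meson divide_pos_pos zero_less_numeral)
    obtain N where N: "\<forall>n\<ge>N. norm (module_norm ipH (F n - g n) - 0) < e / 3"
      using g0 e unfolding LIMSEQ_iff by (meson divide_pos_pos zero_less_numeral)
    have "module_norm ipX (g m - g n) < e" if "m \<ge> max M N" "n \<ge> max M N" for m n
    proof -
      have "module_norm ipX (g m - g n) = module_norm ipH (g m - g n)"
        using gX by (simp add: module_norm_ipH_eq F.diff_mem)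
      also have "\<dots> \<le> module_norm ipH (g m - F m) + module_norm ipH (F m - g n)"
        by (intro H.module_norm_diff_triangle gH FH)
      also have "\<dots> \<le> module_norm ipH (F m - g m) + (module_norm ipH (F m - F n) + module_norm ipH (F n - g n))"
        using H.module_norm_diff_triangle[OF FH[of m] FH[of n] gH[of n]]
          H.module_norm_minus_commute[OF gH[of m] FH[of m]] by simp
      also have "\<dots> < e"
        using M[rule_format, of m n] N[rule_format, of m] N[rule_format, of n] that by simp
      finally show ?thesis .
    qed
    then show "\<exists>N. \<forall>m\<ge>N. \<forall>n\<ge>N. module_norm ipX (g m - g n) < e" by blast
  qed
  have "\<exists>l. module_tendsto ip (\<lambda>n. g n s) l" for s
  proof -
    obtain C where C: "C \<ge> 0" "\<forall>f\<in>X. module_norm ip (f s) \<le> C * module_norm ipX f"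
      using eval_bounded by blast
    have "module_norm ip (g m s - g n s) \<le> C * module_norm ipX (g m - g n) + 0 * module_norm ipX (g m - g n)"
      for m n using C(2) F.diff_mem[OF gX[of m] gX[of n]] by fastforce
    then have "module_Cauchy ip (\<lambda>n. g n s)"
      by (rule module_Cauchy_combine[OF gC gC C(1) order_refl])
    then show ?thesis
      using E.complete[of "\<lambda>n. g n s"] unfolding module_Cauchy_def module_tendsto_def by blast
  qed
  then obtain G where "\<And>s. module_tendsto ip (\<lambda>n. g n s) (G s)" by metis
  then have a: "approx g G" using gX gC by (simp add: approx_def)
  then have GH: "G \<in> H" by (rule H_I)
  have "(\<lambda>n. module_norm ipH (F n - g n) + module_norm ipH (g n - G)) \<longlonglongrightarrow> 0"
    using tendsto_add[OF g0 approx_module_tendsto[OF a, unfolded module_tendsto_def]] by simp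
  then have "(\<lambda>n. module_norm ipH (F n - G)) \<longlonglongrightarrow> 0"
    by (rule module_norm_squeeze) (rule H.module_norm_diff_triangle[OF FH gH GH])
  then show ?thesis using GH by (auto simp: module_tendsto_def)
qed

theorem hilbert_cstar_module_H: "hilbert_cstar_module H (fun_act act) ipH"
proof (rule hilbert_cstar_module.intro)
  show "\<exists>l\<in>H. (\<lambda>n. module_norm ipH (f n - l)) \<longlonglongrightarrow> 0"
    if "\<And>n. f n \<in> H" "\<And>e. e > 0 \<Longrightarrow> \<exists>N. \<forall>m\<ge>N. \<forall>n\<ge>N. module_norm ipH (f m - f n) < e" for f
    using H_complete[of f] that unfolding module_Cauchy_def module_tendsto_def by blast
qed (rule H.zero_mem H.add_mem H.scaleC_mem H.act_mem H.ip_add_right H.ip_scaleC_right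
    H.ip_act_right H.ip_star H.ip_pos ipH_definite; assumption
    | simp add: fun_act_def E.act_add_left E.act_add_right E.act_mult E.act_scaleC_left
        E.act_scaleC_right scaleC_fun_def fun_eq_iff)+

end

section \<open>The reproducing kernel module of a positive definite kernel\<close>

lemma (in full_hilbert_module) hermitian_kernel_iff:
  "hermitian_kernel ip K \<longleftrightarrow> (\<forall>s t. is_adjoint ip (K s t) (K t s))"
  unfolding hermitian_kernel_def
  by (metis adjointable_def is_adjoint_op_adj op_adj_eq)

lemma (in full_hilbert_module) ip_sum_left: "ip (\<Sum>i\<in>I. f i) y = (\<Sum>i\<in>I. ip (f i) y)"
  by (induction I rule: infinite_finite_induct) (auto simp: E.ip_add_left)

lemma (in full_hilbert_module) ip_minus_left: "ip (- x) y = - ip x y"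
  using E.ip_diff_left[of 0 x y] by simp

lemma (in full_hilbert_module) ip_minus_right: "ip x (- y) = - ip x y"
  by (rule E.ip_minus_right) simp_all

lemma (in full_hilbert_module) ip_sum_right: "ip y (\<Sum>i\<in>I. f i) = (\<Sum>i\<in>I. ip y (f i))"
  by (induction I rule: infinite_finite_induct) (auto simp: E.ip_add_right)

locale positive_kernel = full_hilbert_module act ip
  for act :: "'e::complex_vector \<Rightarrow> 'a::cstar_algebra \<Rightarrow> 'e" and ip +
  fixes K :: "'s \<Rightarrow> 's \<Rightarrow> 'e \<Rightarrow> 'e"
  assumes pd: "positive_definite_kernel ip K"
begin

lemma K_adj: "is_adjoint ip (K s t) (K t s)"
  using pd by (simp add: positive_definite_kernel_def hermitian_kernel_iff)

lemma K_adjointable: "adjointable ip (K s t)"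
  using K_adj adjointable_def by blast

lemmas K_scaleC = adjointable_scaleC[OF K_adjointable]
  and K_act = adjointable_act[OF K_adjointable]

lemma K_zero [simp]: "K s t 0 = 0"
  using K_scaleC[of s t 0 0] by simp

lemma kernel_fun_zero: "kernel_fun K 0 s = 0"
  by (rule ext) (simp add: kernel_fun_def)

text \<open>
  Lists of pairs are formal sums of kernel functions. The value of a formal sum is a function, and different
  lists may give the same function.
\<close>

definition comb :: "('e \<times> 's) list \<Rightarrow> 's \<Rightarrow> 'e" where
  "comb p = (\<Sum>(x, s)\<leftarrow>p. kernel_fun K x s)"

text \<open>
  The inner product of a function with a formal sum, as dictated by the reproducing property.
\<close>

definition pairing :: "('s \<Rightarrow> 'e) \<Rightarrow> ('e \<times> 's) list \<Rightarrow> 'a" where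
  "pairing f q = (\<Sum>(y, t)\<leftarrow>q. ip (f t) y)"

lemma comb_simps [simp]: "comb [] = 0" "comb ((x, s) # p) = kernel_fun K x s + comb p"
  "comb (p @ q) = comb p + comb q"
  by (simp_all add: comb_def)

lemma pairing_simps [simp]: "pairing f [] = 0" "pairing f ((y, t) # q) = ip (f t) y + pairing f q"
  "pairing f (p @ q) = pairing f p + pairing f q"
  by (simp_all add: pairing_def)

lemma pairing_add: "pairing (f + g) q = pairing f q + pairing g q"
  by (induction q) (auto simp: E.ip_add_left)

lemma pairing_zero: "pairing 0 q = 0"
  by (induction q) auto

lemma ip_comb: "ip (comb p t) y = star (pairing (kernel_fun K y t) p)"
proof (induction p)
  case (Cons xs p)
  obtain x s where [simp]: "xs = (x, s)" by fastforce
  have "ip (K s t x) y = star (ip y (K s t x))" by (rule E.ip_star; simp)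
  also have "\<dots> = star (ip (K t s y) x)" by (simp add: is_adjointD[OF K_adj])
  finally show ?case using Cons by (simp add: E.ip_add_left star_add kernel_fun_def)
qed simp

text \<open>
  Hermitian symmetry of \<open>K\<close>. It implies that the pairing depends on the formal sum \<open>q\<close> only through the
  function \<open>comb q\<close>.
\<close>

lemma pairing_comb_star: "pairing (comb p) q = star (pairing (comb q) p)"
proof (induction q)
  case Nil
  show "pairing (comb p) [] = star (pairing (comb []) p)" by (simp add: pairing_zero)
next
  case (Cons yt q)
  obtain y t where [simp]: "yt = (y, t)" by fastforce
  show "pairing (comb p) (yt # q) = star (pairing (comb (yt # q)) p)"
    by (simp add: pairing_add star_add ip_comb Cons)
qed

lemma pairing_comb_cong: "comb q = comb q' \<Longrightarrow> pairing (comb p) q = pairing (comb p) q'"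
  using pairing_comb_star by metis

lemma pairing_comb_pos: "cstar_pos (pairing (comb p) p)"
proof -
  \<comment> \<open>Positive definiteness speaks of at least two points; two zero vectors change nothing.\<close>
  define q where "q = p @ [(0, undefined), (0, undefined)]"
  let ?s = "\<lambda>i. snd (q ! (i - 1))" and ?x = "\<lambda>i. fst (q ! (i - 1))"
  have "cstar_pos (\<Sum>i=1..length q. \<Sum>j=1..length q. ip (K (?s i) (?s j) (?x i)) (?x j))"
    using conjunct2[OF pd[unfolded positive_definite_kernel_def], rule_format, of "length q" ?s ?x]
    by (simp add: q_def)
  also have "(\<Sum>i=1..length q. \<Sum>j=1..length q. ip (K (?s i) (?s j) (?x i)) (?x j))
      = (\<Sum>i<length q. \<Sum>j<length q. ip (K (snd (q ! i)) (snd (q ! j)) (fst (q ! i))) (fst (q ! j)))"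
    by (simp add: sum.atLeast1_atMost_eq)
  also have "\<dots> = (\<Sum>j<length q. ip (comb q (snd (q ! j))) (fst (q ! j)))"
  proof -
    have "comb q t = (\<Sum>i<length q. K (snd (q ! i)) t (fst (q ! i)))" for t
      by (induction q) (auto simp: sum.lessThan_Suc_shift kernel_fun_def simp del: sum.lessThan_Suc)
    then show ?thesis by (simp add: ip_sum_left) (rule sum.swap)
  qed
  also have "\<dots> = pairing (comb q) q"
    by (simp add: pairing_def sum_list_sum_nth atLeast0LessThan case_prod_beta)
  also have "\<dots> = pairing (comb p) p"
    by (simp add: q_def pairing_add kernel_fun_zero pairing_zero)
  finally show ?thesis .
qed

definition ip_pre :: "('s \<Rightarrow> 'e) \<Rightarrow> ('s \<Rightarrow> 'e) \<Rightarrow> 'a" where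
  "ip_pre f g = pairing f (SOME q. comb q = g)"

lemma ip_pre_comb: "f \<in> range comb \<Longrightarrow> ip_pre f (comb q) = pairing f q"
proof -
  assume "f \<in> range comb"
  moreover have "comb (SOME q'. comb q' = comb q) = comb q" by (rule someI) (rule refl)
  ultimately show ?thesis unfolding ip_pre_def using pairing_comb_cong by blast
qed

lemma kernel_fun_range: "kernel_fun K x s \<in> range comb"
  by (rule range_eqI[of _ _ "[(x, s)]"]) simp

lemma ip_pre_kernel_fun: "f \<in> range comb \<Longrightarrow> ip_pre f (kernel_fun K x s) = ip (f s) x"
  using ip_pre_comb[of f "[(x, s)]"] by simp

lemma act_zero [simp]: "act 0 a = 0"
  using E.act_add_left[of 0 0 a] by simp

lemma kernel_fun_scaleC: "kernel_fun K (c *\<^sub>C x) s = c *\<^sub>C kernel_fun K x s"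
  by (rule ext) (simp add: kernel_fun_def K_scaleC scaleC_fun_def)

lemma kernel_fun_act: "kernel_fun K (act x a) s = fun_act act (kernel_fun K x s) a"
  by (rule ext) (simp add: kernel_fun_def K_act fun_act_def)

lemma comb_scaleC: "c *\<^sub>C comb p = comb (map (\<lambda>(x, s). (c *\<^sub>C x, s)) p)"
proof (induction p)
  case Nil
  show "c *\<^sub>C comb [] = comb (map (\<lambda>(x, s). (c *\<^sub>C x, s)) [])" by simp
next
  case (Cons xs p)
  obtain x s where [simp]: "xs = (x, s)" by fastforce
  show "c *\<^sub>C comb (xs # p) = comb (map (\<lambda>(x, s). (c *\<^sub>C x, s)) (xs # p))"
    using Cons by (simp add: kernel_fun_scaleC scaleC_add_right)
qed

lemma comb_act: "fun_act act (comb p) a = comb (map (\<lambda>(x, s). (act x a, s)) p)"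
proof (induction p)
  case Nil
  show ?case by (rule ext) (simp add: fun_act_def)
next
  case (Cons xs p)
  obtain x s where [simp]: "xs = (x, s)" by fastforce
  have "fun_act act (kernel_fun K x s + comb p) a
      = fun_act act (kernel_fun K x s) a + fun_act act (comb p) a"
    by (rule ext) (simp add: fun_act_def E.act_add_left)
  then show "fun_act act (comb (xs # p)) a = comb (map (\<lambda>(x, s). (act x a, s)) (xs # p))"
    using Cons by (simp add: kernel_fun_act)
qed

lemma pairing_scaleC: "pairing f (map (\<lambda>(x, s). (c *\<^sub>C x, s)) p) = c *\<^sub>C pairing f p"
  by (induction p) (auto simp: E.ip_scaleC_right scaleC_add_right)

lemma pairing_act: "pairing f (map (\<lambda>(x, s). (act x a, s)) p) = pairing f p * a"
  by (induction p) (auto simp: E.ip_act_right distrib_right)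

sublocale P: semi_inner_module "range comb" "fun_act act" ip_pre
proof
  show "0 \<in> range comb" by (rule range_eqI[of _ _ "[]"]) simp
next
  fix f g assume "f \<in> range comb" "g \<in> range comb"
  then obtain p q where "f = comb p" "g = comb q" by blast
  then show "f + g \<in> range comb" by (intro range_eqI[of _ _ "p @ q"]) simp
next
  fix f c assume "f \<in> range comb"
  then obtain p where "f = comb p" by blast
  then show "c *\<^sub>C f \<in> range comb" by (simp add: comb_scaleC)
next
  fix f a assume "f \<in> range comb"
  then obtain p where "f = comb p" by blast
  then show "fun_act act f a \<in> range comb" by (simp add: comb_act)
next
  fix f g h assume f: "f \<in> range comb" and "g \<in> range comb" "h \<in> range comb"
  then obtain q r where "g = comb q" "h = comb r" by blast
  then show "ip_pre f (g + h) = ip_pre f g + ip_pre f h"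
    using ip_pre_comb[OF f, of "q @ r"] by (simp add: ip_pre_comb[OF f])
next
  fix f g c assume f: "f \<in> range comb" and "g \<in> range comb"
  then obtain q where "g = comb q" by blast
  then show "ip_pre f (c *\<^sub>C g) = c *\<^sub>C ip_pre f g"
    by (simp add: comb_scaleC ip_pre_comb[OF f] pairing_scaleC)
next
  fix f g a assume f: "f \<in> range comb" and "g \<in> range comb"
  then obtain q where "g = comb q" by blast
  then show "ip_pre f (fun_act act g a) = ip_pre f g * a"
    by (simp add: comb_act ip_pre_comb[OF f] pairing_act)
next
  fix f g assume fg: "f \<in> range comb" "g \<in> range comb"
  then obtain p q where "f = comb p" "g = comb q" by blast
  then show "ip_pre g f = star (ip_pre f g)"
    using pairing_comb_star[of q p] fg by (simp add: ip_pre_comb)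
next
  fix f assume "f \<in> range comb"
  then obtain p where "f = comb p" by blast
  then show "cstar_pos (ip_pre f f)" using pairing_comb_pos by (simp add: ip_pre_comb)
qed

text \<open>
  With \<open>y = f s\<close> one has \<open>\<langle>y, y\<rangle> = \<langle>f, K\<^bsub>y,s\<^esub>\<rangle>\<close>, and \<open>\<langle>K\<^bsub>y,s\<^esub>, K\<^bsub>y,s\<^esub>\<rangle> = \<langle>K(s, s) y, y\<rangle>\<close> is bounded by a
  multiple of \<open>norm y ^ 2\<close> because \<open>K(s, s)\<close> is a bounded operator.
\<close>

lemma eval_bounded_pre:
  "\<exists>C\<ge>0. \<forall>f\<in>range comb. module_norm ip (f s) \<le> C * module_norm ip_pre f"
proof -
  obtain C where C: "C \<ge> 0" "\<And>x. module_norm ip (K s s x) \<le> C * module_norm ip x"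
    using adjointable_bounded[OF K_adjointable] by blast
  have "module_norm ip (f s) \<le> sqrt C * module_norm ip_pre f" if f: "f \<in> range comb" for f
  proof -
    let ?y = "f s" and ?k = "kernel_fun K (f s) s"
    have "(module_norm ip_pre ?k)\<^sup>2 = norm (ip (K s s ?y) ?y)"
      by (simp add: module_norm_square ip_pre_kernel_fun kernel_fun_range) (simp add: kernel_fun_def)
    also have "\<dots> \<le> module_norm ip (K s s ?y) * module_norm ip ?y"
      by (rule E.Cauchy_Schwarz) auto
    also have "\<dots> \<le> (C * module_norm ip ?y) * module_norm ip ?y"
      using C(2) by (intro mult_right_mono) auto
    also have "\<dots> = (sqrt C * module_norm ip ?y)\<^sup>2"
      using C(1) by (simp add: power2_eq_square algebra_simps)
    finally have k: "module_norm ip_pre ?k \<le> sqrt C * module_norm ip ?y"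
      by (rule power2_le_imp_le) (simp add: C(1))
    have "(module_norm ip ?y)\<^sup>2 = norm (ip_pre f ?k)"
      by (simp add: module_norm_square ip_pre_kernel_fun f)
    also have "\<dots> \<le> module_norm ip_pre f * module_norm ip_pre ?k"
      by (rule P.Cauchy_Schwarz[OF f kernel_fun_range])
    also have "\<dots> \<le> module_norm ip_pre f * (sqrt C * module_norm ip ?y)"
      using k by (intro mult_left_mono) auto
    finally have "module_norm ip ?y * module_norm ip ?y
        \<le> (sqrt C * module_norm ip_pre f) * module_norm ip ?y"
      by (simp add: power2_eq_square algebra_simps)
    then show ?thesis
    proof (cases "module_norm ip ?y = 0")
      case False
      then have "module_norm ip ?y > 0" using module_norm_nonneg[of ip ?y] by linarith
      then show ?thesis
        using \<open>module_norm ip ?y * module_norm ip ?y \<le> _\<close> mult_right_le_imp_le by blast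
    qed (simp add: C(1))
  qed
  then show ?thesis using C(1) by (intro exI[of _ "sqrt C"]) auto
qed

lemma pairing_tendsto_zero:
  assumes "\<And>s. module_tendsto ip (\<lambda>n. f n s) 0"
  shows "(\<lambda>n. pairing (f n) q) \<longlonglongrightarrow> 0"
proof (induction q)
  case (Cons yt q)
  obtain y t where [simp]: "yt = (y, t)" by fastforce
  have "(\<lambda>n. ip (f n t) y) \<longlonglongrightarrow> ip 0 y"
    by (rule E.module_tendsto_ip) (simp_all add: assms)
  then show ?case using tendsto_add[OF _ Cons] by fastforce
qed simp

text \<open>
  Split \<open>\<langle>f\<^sub>n, f\<^sub>n\<rangle> = \<langle>f\<^sub>n, f\<^sub>n - f\<^sub>M\<rangle> + \<langle>f\<^sub>n, f\<^sub>M\<rangle>\<close>. The first term is small by the Cauchy condition, and the second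
  one tends to zero because \<open>f\<^sub>M\<close> is a fixed finite sum of kernel functions.
\<close>

lemma null_pre:
  assumes f: "\<And>n. f n \<in> range comb" and C: "module_Cauchy ip_pre f"
    and pt: "\<And>s. module_tendsto ip (\<lambda>n. f n s) 0"
  shows "module_tendsto ip_pre f 0"
proof -
  obtain B where B: "\<And>n. module_norm ip_pre (f n) \<le> B"
    using P.module_Cauchy_bounded[OF f C] by metis
  define D where "D = B + 1"
  have D: "D > 0" "\<And>n. module_norm ip_pre (f n) \<le> D"
  proof -
    show "D > 0" using order_trans[OF module_norm_nonneg B[of 0]] by (simp add: D_def)
    show "module_norm ip_pre (f n) \<le> D" for n using B[of n] by (simp add: D_def)
  qed
  have "(\<lambda>n. ip_pre (f n) (f n)) \<longlonglongrightarrow> 0"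
  proof (rule LIMSEQ_I)
    fix r :: real assume r: "r > 0"
    then have "r / (2 * D) > 0" using D by simp
    then obtain M where M: "\<And>n. n \<ge> M \<Longrightarrow> module_norm ip_pre (f n - f M) < r / (2 * D)"
      using C unfolding module_Cauchy_def by (meson order_refl)
    obtain q where q: "f M = comb q" using f by blast
    obtain N where N: "\<And>n. n \<ge> N \<Longrightarrow> norm (pairing (f n) q - 0) < r / 2"
      using pairing_tendsto_zero[OF pt, where q = q] half_gt_zero[OF r] unfolding LIMSEQ_iff by meson
    have "norm (ip_pre (f n) (f n) - 0) < r" if "n \<ge> max M N" for n
    proof -
      have "ip_pre (f n) (f n) = ip_pre (f n) (f n - f M) + pairing (f n) q"
        using f by (simp add: P.ip_diff_right q ip_pre_comb)
      then have "norm (ip_pre (f n) (f n))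
          \<le> norm (ip_pre (f n) (f n - f M)) + norm (pairing (f n) q)"
        using norm_triangle_ineq by metis
      also have "norm (ip_pre (f n) (f n - f M)) \<le> module_norm ip_pre (f n) * module_norm ip_pre (f n - f M)"
        using f by (intro P.Cauchy_Schwarz P.diff_mem)
      also have "\<dots> \<le> D * (r / (2 * D))"
        using D(2)[of n] M[of n] that D(1) by (intro mult_mono) auto
      finally show ?thesis using N[of n] that D(1) by simp
    qed
    then show "\<exists>no. \<forall>n\<ge>no. norm (ip_pre (f n) (f n) - 0) < r" by blast
  qed
  then have "(\<lambda>n. module_norm ip_pre (f n)) \<longlonglongrightarrow> sqrt (norm (0::'a))"
    unfolding module_norm_def by (intro tendsto_intros)
  then show ?thesis by (simp add: module_tendsto_def)
qed

sublocale R: function_module act ip "range comb" ip_pre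
  by unfold_locales (fact eval_bounded_pre, fact null_pre)

lemma module_span_add:
  assumes "g \<in> module_span act' M" "k \<in> M"
  shows "g + act' k a \<in> module_span act' M"
proof -
  obtain n :: nat and h b where h: "g = (\<Sum>i<n. act' (h i) (b i))" "\<forall>i<n. h i \<in> M"
    using assms(1) unfolding module_span_def by blast
  let ?h = "h(n := k)" and ?b = "b(n := a)"
  have "g + act' k a = (\<Sum>i<Suc n. act' (?h i) (?b i))" by (simp add: h(1))
  moreover have "\<forall>i<Suc n. ?h i \<in> M" using h(2) assms(2) by (auto simp: less_Suc_eq)
  ultimately show ?thesis unfolding module_span_def by blast
qed

text \<open>
  The span has coefficients from an algebra that may lack a unit, so a kernel function need not lie in it;
  but it is approximated by its multiples.
\<close>

lemma comb_approx_by_span: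
  assumes "e > 0"
  shows "\<exists>g\<in>module_span (fun_act act) {kernel_fun K x s | x s. True}.
    g \<in> range comb \<and> module_norm ip_pre (comb p - g) < e"
  using assms
proof (induction p arbitrary: e)
  case Nil
  have "0 \<in> module_span (fun_act act) {kernel_fun K x s | x s. True}"
    unfolding module_span_def by (auto intro!: exI[of _ "0::nat"])
  then show "\<exists>g\<in>module_span (fun_act act) {kernel_fun K x s | x s. True}.
      g \<in> range comb \<and> module_norm ip_pre (comb [] - g) < e"
    using Nil P.zero_mem by (intro bexI[of _ 0]) simp_all
next
  case (Cons xs p)
  obtain x s where [simp]: "xs = (x, s)" by fastforce
  let ?S = "{kernel_fun K x s | x s. True}" and ?k = "kernel_fun K x s"
  obtain g where
    g: "g \<in> module_span (fun_act act) ?S" "g \<in> range comb" "module_norm ip_pre (comb p - g) < e / 2"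
    using Cons.IH[OF half_gt_zero[OF Cons.prems]] by blast
  obtain u where u: "module_norm ip_pre (?k - fun_act act ?k u) < e / 2"
    using P.approximate_by_act[OF kernel_fun_range half_gt_zero[OF Cons.prems]] by blast
  let ?g = "g + fun_act act ?k u"
  have "?g \<in> module_span (fun_act act) ?S" by (rule module_span_add[OF g(1)]) blast
  moreover have "?g \<in> range comb" by (intro P.add_mem P.act_mem g kernel_fun_range)
  moreover have "module_norm ip_pre (?k + comb p - (fun_act act ?k u + g)) < e"
    using P.module_norm_add_diff_le[OF kernel_fun_range rangeI P.act_mem[OF kernel_fun_range] g(2), of x s p x s u]
      u g(3) by simp
  ultimately show "\<exists>g\<in>module_span (fun_act act) ?S.
      g \<in> range comb \<and> module_norm ip_pre (comb (xs # p) - g) < e"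
    by (intro bexI[of _ ?g]) (simp_all add: add.commute)
qed

theorem reproducing: "reproducing_kernel_module act ip K R.H R.ipH"
  unfolding reproducing_kernel_module_def
proof (intro conjI allI ballI impI)
  show "hilbert_cstar_module R.H (fun_act act) R.ipH" by (rule R.hilbert_cstar_module_H)
  show kH: "kernel_fun K x s \<in> R.H" for x s using R.subset_H kernel_fun_range by blast
  show "R.ipH (kernel_fun K x s) (kernel_fun K y t) = ip (K s t x) y" for x y s t
    by (simp add: R.ipH_eq_ipX kernel_fun_range ip_pre_kernel_fun) (simp add: kernel_fun_def)
  show "ip (F s) x = R.ipH F (kernel_fun K x s)" if F: "F \<in> R.H" for F x s
  proof -
    obtain f where a: "R.approx f F" using R.H_E[OF F] by blast
    have "(\<lambda>n. ip (f n s) x) \<longlonglongrightarrow> ip (F s) x"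
      by (rule E.module_tendsto_ip) (simp_all add: R.approxD[OF a])
    then have "(\<lambda>n. ip_pre (f n) (kernel_fun K x s)) \<longlonglongrightarrow> ip (F s) x"
      by (simp add: ip_pre_kernel_fun R.approxD[OF a])
    from R.approx_ip_eq[OF a R.approx_const[OF kernel_fun_range] this] show ?thesis by simp
  qed
  show "\<exists>g\<in>module_span (fun_act act) {kernel_fun K x s |x s. True}. module_norm R.ipH (F - g) < e"
    if F: "F \<in> R.H" and e: "e > 0" for F e
  proof -
    obtain f where f: "f \<in> range comb" "module_norm R.ipH (F - f) < e / 2"
      using R.dense_in_H[OF F half_gt_zero[OF e]] .
    then obtain p where p: "f = comb p" by blast
    obtain g where g: "g \<in> module_span (fun_act act) {kernel_fun K x s |x s. True}"
        "g \<in> range comb" "module_norm ip_pre (f - g) < e / 2"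
      using comb_approx_by_span[OF half_gt_zero[OF e], of p] p by blast
    have "module_norm R.ipH (F - g) \<le> module_norm R.ipH (F - f) + module_norm R.ipH (f - g)"
      using f g R.subset_H F by (intro R.H.module_norm_diff_triangle) auto
    also have "\<dots> < e" using f g by (simp add: R.module_norm_ipH_eq P.diff_mem)
    finally show ?thesis using g(1) by blast
  qed
qed

end

section \<open>Conditionally negative definite kernels\<close>

context full_hilbert_module
begin

text \<open>
  The point \<open>s0\<close> is appended at index \<open>Suc n\<close> with the vector \<open>x0\<close> that makes the sum vanish. The
  resulting row, column and corner of the double sum are double sums over the original
  indices again, since \<open>x0\<close> is minus the sum of the \<open>x\<^sub>i\<close>.
\<close>

lemma positive_definite_of_cond_negative:
  fixes L K :: "'s \<Rightarrow> 's \<Rightarrow> 'e \<Rightarrow> 'e"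
  assumes L: "cond_negative_definite_kernel ip L"
    and K: "\<And>s t. K s t = (1/2) *\<^sub>C (L s s0 + L s0 t - L s t - L s0 s0)"
  shows "positive_definite_kernel ip K"
  unfolding positive_definite_kernel_def
proof (intro conjI allI impI)
  have adj: "is_adjoint ip (L s t) (L t s)" for s t
    using L by (simp add: cond_negative_definite_kernel_def hermitian_kernel_iff)
  have "is_adjoint ip (K s t) (K t s)" for s t
  proof -
    have "is_adjoint ip (K s t) (cnj (1/2) *\<^sub>C (L s0 s + L t s0 - L t s - L s0 s0))"
      unfolding K by (intro is_adjoint_scaleC is_adjoint_add is_adjoint_diff adj)
    then show ?thesis by (simp add: K add.commute)
  qed
  then show "hermitian_kernel ip K" by (simp add: hermitian_kernel_iff)
  fix n :: nat and s :: "nat \<Rightarrow> 's" and x :: "nat \<Rightarrow> 'e"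
  assume n: "2 \<le> n"
  define x0 where "x0 = - (\<Sum>i=1..n. x i)"
  define s' where "s' = s(Suc n := s0)"
  define x' where "x' = x(Suc n := x0)"
  let ?l = "\<lambda>s t x y. ip (L s t x) y"
  have "(\<Sum>i=1..Suc n. x' i) = (\<Sum>i=1..n. x' i) + x0" by (simp add: x'_def)
  also have "(\<Sum>i=1..n. x' i) = (\<Sum>i=1..n. x i)" by (rule sum.cong) (auto simp: x'_def)
  finally have "(\<Sum>i=1..Suc n. x' i) = 0" by (simp add: x0_def)
  then have pos: "cstar_pos (- (\<Sum>i=1..Suc n. \<Sum>j=1..Suc n. ?l (s' i) (s' j) (x' i) (x' j)))"
    using L n unfolding cond_negative_definite_kernel_def by (meson le_Suc_eq)
  have Lsum: "L a b (- (\<Sum>i=1..n. x i)) = - (\<Sum>i=1..n. L a b (x i))" for a b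
  proof (rule eq_if_ip_eq)
    show "ip (L a b (- (\<Sum>i=1..n. x i))) z = ip (- (\<Sum>i=1..n. L a b (x i))) z" for z
      by (simp add: is_adjointD[OF adj] ip_sum_left ip_minus_left)
  qed
  have "(\<Sum>i=1..Suc n. \<Sum>j=1..Suc n. ?l (s' i) (s' j) (x' i) (x' j))
      = (\<Sum>i=1..n. (\<Sum>j=1..n. ?l (s i) (s j) (x i) (x j)) + ?l (s i) s0 (x i) x0)
        + ((\<Sum>j=1..n. ?l s0 (s j) x0 (x j)) + ?l s0 s0 x0 x0)"
    by (simp add: s'_def x'_def)
  also have "\<dots> = (\<Sum>i=1..n. \<Sum>j=1..n. ?l (s i) (s j) (x i) (x j) - ?l (s i) s0 (x i) (x j)
        - ?l s0 (s j) (x i) (x j) + ?l s0 s0 (x i) (x j))"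
  proof -
    have 1: "?l (s i) s0 (x i) x0 = - (\<Sum>j=1..n. ?l (s i) s0 (x i) (x j))" for i
      by (simp add: x0_def E.ip_minus_right ip_sum_right)
    have "(\<Sum>j=1..n. ?l s0 (s j) x0 (x j)) = - (\<Sum>j=1..n. \<Sum>i=1..n. ?l s0 (s j) (x i) (x j))"
      unfolding x0_def Lsum ip_minus_left ip_sum_left sum_negf ..
    also have "\<dots> = - (\<Sum>i=1..n. \<Sum>j=1..n. ?l s0 (s j) (x i) (x j))" by (subst sum.swap) simp
    finally have 2: "(\<Sum>j=1..n. ?l s0 (s j) x0 (x j)) = - (\<Sum>i=1..n. \<Sum>j=1..n. ?l s0 (s j) (x i) (x j))" .
    have 3: "?l s0 s0 x0 x0 = (\<Sum>i=1..n. \<Sum>j=1..n. ?l s0 s0 (x i) (x j))"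
      unfolding x0_def Lsum ip_minus_left ip_minus_right ip_sum_left ip_sum_right sum_negf minus_minus
      by (rule sum.swap)
    show ?thesis unfolding 1 2 3 by (simp add: sum.distrib sum_subtractf)
  qed
  finally have eq: "(\<Sum>i=1..Suc n. \<Sum>j=1..Suc n. ?l (s' i) (s' j) (x' i) (x' j)) = \<dots>" .
  have "(1/2::real) *\<^sub>R (- (\<Sum>i=1..Suc n. \<Sum>j=1..Suc n. ?l (s' i) (s' j) (x' i) (x' j)))
      = (\<Sum>i=1..n. \<Sum>j=1..n. ip (K (s i) (s j) (x i)) (x j))"
  proof -
    have "ip (K (s i) (s j) (x i)) (x j) = (1/2) *\<^sub>R (- (?l (s i) (s j) (x i) (x j)
        - ?l (s i) s0 (x i) (x j) - ?l s0 (s j) (x i) (x j) + ?l s0 s0 (x i) (x j)))" for i j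
      by (simp add: K scaleC_fun_def E.ip_scaleC_left E.ip_diff_left E.ip_add_left scaleR_eq_scaleC
          algebra_simps)
    then show ?thesis unfolding eq by (simp only: scaleR_sum_right sum_negf[symmetric])
  qed
  then show "cstar_pos (\<Sum>i=1..n. \<Sum>j=1..n. ip (K (s i) (s j) (x i)) (x j))"
    using cstar_pos_scaleR[OF pos, of "1/2"] by simp
qed

end

theorem theorem4p6:
  fixes act :: "'e::complex_vector \<Rightarrow> 'a::cstar_algebra \<Rightarrow> 'e"
    and ip :: "'e \<Rightarrow> 'e \<Rightarrow> 'a"
    and L K :: "'s \<Rightarrow> 's \<Rightarrow> 'e \<Rightarrow> 'e"
    and s0 :: 's
  assumes E: "hilbert_cstar_module UNIV act ip"
    and L: "cond_negative_definite_kernel ip L"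
    and K: "\<And>s t. K s t = (1/2) *\<^sub>C (L s s0 + L s0 t - L s t - L s0 s0)"
  shows "positive_definite_kernel ip K \<and>
    (\<exists>(H :: ('s \<Rightarrow> 'e) set) (ipH :: ('s \<Rightarrow> 'e) \<Rightarrow> ('s \<Rightarrow> 'e) \<Rightarrow> 'a) (\<psi> :: 's \<Rightarrow> 'e \<Rightarrow> 'e).
       reproducing_kernel_module act ip K H ipH \<and>
       (\<forall>s. adjointable ip (\<psi> s)) \<and>
       (\<forall>s t. L s t = K s s + K t t - 2 *\<^sub>C K s t + \<psi> s + op_adj ip (\<psi> t)) \<and>
       ((\<forall>s. \<psi> s = 0) \<longleftrightarrow>
          normalized_kernel L \<and> (\<forall>s. op_adj ip (L s s0) = L s s0)))"
proof (intro conjI exI)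
  interpret full_hilbert_module act ip by (rule full_hilbert_module.intro[OF E])
  show pd: "positive_definite_kernel ip K" by (rule positive_definite_of_cond_negative[OF L K])
  interpret P: positive_kernel act ip K by unfold_locales (rule pd)
  show "reproducing_kernel_module act ip K P.R.H P.R.ipH" by (rule P.reproducing)
  have adj: "is_adjoint ip (L s t) (L t s)" for s t
    using L by (simp add: cond_negative_definite_kernel_def hermitian_kernel_iff)
  let ?\<psi> = "\<lambda>s. (1/2) *\<^sub>C (L s s + L s s0 - L s0 s)"
  have psi: "is_adjoint ip (?\<psi> s) ((1/2) *\<^sub>C (L s s + L s0 s - L s s0))" for s
  proof -
    have "is_adjoint ip (?\<psi> s) (cnj (1/2) *\<^sub>C (L s s + L s0 s - L s s0))"
      by (intro is_adjoint_scaleC is_adjoint_add is_adjoint_diff adj)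
    then show ?thesis by simp
  qed
  then show "\<forall>s. adjointable ip (?\<psi> s)" by (auto simp: adjointable_def)
  show "\<forall>s t. L s t = K s s + K t t - 2 *\<^sub>C K s t + ?\<psi> s + op_adj ip (?\<psi> t)"
  proof (intro allI ext)
    fix s t x
    \<comment> \<open>Both sides are combinations of operators with half-integer coefficients; splitting the terms into halves leaves an identity in an abelian group.\<close>
    have split: "z = (1/2) *\<^sub>C z + (1/2) *\<^sub>C z" for z :: 'e
      by (simp add: scaleC_add_left[symmetric] scaleC_one)
    show "L s t x = (K s s + K t t - 2 *\<^sub>C K s t + ?\<psi> s + op_adj ip (?\<psi> t)) x"
      unfolding op_adj_eq[OF psi] K
      using split[of "L s t x"] split[of "L s s0 x"] split[of "L s0 t x"] split[of "L s0 s0 x"]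
      by (simp add: scaleC_fun_def scaleC_scaleC scaleC_one scaleC_add_right scaleC_diff_right
          algebra_simps)
  qed
  show "(\<forall>s. ?\<psi> s = 0) \<longleftrightarrow> normalized_kernel L \<and> (\<forall>s. op_adj ip (L s s0) = L s s0)"
  proof
    assume "normalized_kernel L \<and> (\<forall>s. op_adj ip (L s s0) = L s s0)"
    then show "\<forall>s. ?\<psi> s = 0" using op_adj_eq[OF adj] by (simp add: normalized_kernel_def)
  next
    assume 0: "\<forall>s. ?\<psi> s = 0"
    have z: "L s s + L s s0 - L s0 s = 0" for s
    proof -
      have "2 *\<^sub>C ?\<psi> s = 0" using 0 by simp
      then show ?thesis by (simp add: scaleC_scaleC scaleC_one)
    qed
    \<comment> \<open>The adjoint of the preceding identity; the sum of the two isolates \<open>L s s\<close>.\<close>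
    have z': "L s s + L s0 s - L s s0 = 0" for s
    proof -
      have "is_adjoint ip (L s s + L s s0 - L s0 s) (L s s + L s0 s - L s s0)"
        by (intro is_adjoint_add is_adjoint_diff adj)
      moreover have "is_adjoint ip 0 0" by (simp add: is_adjoint_def)
      ultimately show ?thesis using z is_adjoint_unique by metis
    qed
    have "L s s + L s s = 0" for s
    proof -
      have "L s s + L s s = (L s s + L s s0 - L s0 s) + (L s s + L s0 s - L s s0)" by simp
      then show ?thesis by (simp only: z z' add_0)
    qed
    then have "(1/2) *\<^sub>C (L s s + L s s) = (1/2) *\<^sub>C 0" for s by simp
    then have n: "L s s = 0" for s by (simp add: scaleC_add_right scaleC_add_left[symmetric] scaleC_one)
    moreover have "L s s0 = L s0 s" for s using z[of s] n by simp
    ultimately show "normalized_kernel L \<and> (\<forall>s. op_adj ip (L s s0) = L s s0)"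
      using op_adj_eq[OF adj] by (simp add: normalized_kernel_def)
  qed
qed

end
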